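(* Let $T_1$ and $T_2$ be automorphisms of standard Borel probability spaces such that $T_2$ is a Markov quasi-image of $T_1$. If $T_1$ is a Kolmogorov automorphism (K-automorphism), then $T_2$ is a Kolmogorov automorphism. In particular, the K property is an invariant of Markov quasi-similarity: if $T_1$ and $T_2$ are Markov quasi-similar, then $T_1$ is a K-automorphism if and only if $T_2$ is.
   Context: An automorphism of a standard Borel probability space is an invertible bi-measurable measure-preserving map. For an automorphism $T$ of $(X,\mathcal{B},\mu)$, the Koopman operator is $U_T f=f\circ T$ on $L^2(X,\mathcal{B},\mu)$. A Markov operator $\Phi:L^2(X_1,\mathcal{B}_1,\mu_1)\to L^2(X_2,\mathcal{B}_2,\mu_2)$ is a linear contraction which maps non-negative functions to non-negative functions and satisfies $\Phi\mathbf{1}=\mathbf{1}$ and $\Phi^*\mathbf{1}=\mathbf{1}$. The automorphism $T_2$ is a Markov quasi-image of $T_1$ if there is a Markov operator $\Phi:L^2(X_1,\mathcal{B}_1,\mu_1)\to L^2(X_2,\mathcal{B}_2,\mu_2)$ with dense range such that $\Phi\circ U_{T_1}=U_{T_2}\circ\Phi$. $T_1$ and $T_2$ are Markov quasi-similar if each is a Markov quasi-image of the other. An automorphism is Kolmogorov if it has completely positive entropy, i.e. its only zero-entropy factor is the one-point (trivial) one. *)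

theory Defs
  imports "HOL-Probability.Probability"
begin

section \<open>Automorphisms of standard Borel probability spaces\<close>

definition standard_borel :: "'a measure \<Rightarrow> bool" where
  "standard_borel M \<longleftrightarrow>
     (\<exists>\<tau>. completely_metrizable_space \<tau> \<and> separable_space \<tau> \<and> topspace \<tau> = space M \<and>
          sets M = sigma_sets (topspace \<tau>) {U. openin \<tau> U})"

definition mp_automorphism :: "'a measure \<Rightarrow> ('a \<Rightarrow> 'a) \<Rightarrow> bool" where
  "mp_automorphism M T \<longleftrightarrow>
     prob_space M \<and> bij_betw T (space M) (space M) \<and>
     T \<in> M \<rightarrow>\<^sub>M M \<and> inv_into (space M) T \<in> M \<rightarrow>\<^sub>M M \<and> distr M M T = M"

definition std_automorphism :: "'a measure \<Rightarrow> ('a \<Rightarrow> 'a) \<Rightarrow> bool" where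
  "std_automorphism M T \<longleftrightarrow> standard_borel M \<and> mp_automorphism M T"


section \<open>Kolmogorov--Sinai entropy and Kolmogorov automorphisms\<close>

text \<open>
  A finite measurable partition is given by a simple function \<open>p\<close> with values in the naturals,
  its atoms being the nonempty level sets of \<open>p\<close> in \<open>space M\<close>. The map \<open>itinerary T p n\<close> then
  labels the join of the preimages of this partition under \<open>T ^^ i\<close> for \<open>i < n\<close>. Entropies are
  taken with respect to the natural logarithm.
\<close>

definition partition_entropy :: "'a measure \<Rightarrow> ('a \<Rightarrow> 'c) \<Rightarrow> real" where
  "partition_entropy M p = prob_space.entropy M (exp 1) (count_space (p ` space M)) p"

definition itinerary :: "('a \<Rightarrow> 'a) \<Rightarrow> ('a \<Rightarrow> 'c) \<Rightarrow> nat \<Rightarrow> 'a \<Rightarrow> 'c list" where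
  "itinerary T p n x = map (\<lambda>i. p ((T ^^ i) x)) [0..<n]"

definition entropy_of_partition :: "'a measure \<Rightarrow> ('a \<Rightarrow> 'a) \<Rightarrow> ('a \<Rightarrow> 'c) \<Rightarrow> real" where
  "entropy_of_partition M T p = lim (\<lambda>n. partition_entropy M (itinerary T p n) / real n)"

definition ks_entropy :: "'a measure \<Rightarrow> ('a \<Rightarrow> 'a) \<Rightarrow> ereal" where
  "ks_entropy M T =
     (SUP p \<in> {p :: 'a \<Rightarrow> nat. simple_function M p}. ereal (entropy_of_partition M T p))"

text \<open>
  A factor is an invariant sub-\<open>\<sigma>\<close>-algebra \<open>F\<close>; invariance means that \<open>T\<close> is still invertible
  and bi-measurable on \<open>F\<close>. As an automorphism, the factor is \<open>T\<close> on \<open>restr_to_subalg M F\<close>.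
  It is the one-point factor, up to null sets, when all its sets have measure 0 or 1.
\<close>

definition factor_algebra :: "'a measure \<Rightarrow> ('a \<Rightarrow> 'a) \<Rightarrow> 'a measure \<Rightarrow> bool" where
  "factor_algebra M T F \<longleftrightarrow> subalgebra M F \<and> mp_automorphism (restr_to_subalg M F) T"

definition trivial_factor :: "'a measure \<Rightarrow> 'a measure \<Rightarrow> bool" where
  "trivial_factor M F \<longleftrightarrow> (\<forall>A\<in>sets F. measure M A = 0 \<or> measure M A = 1)"

definition kolmogorov :: "'a measure \<Rightarrow> ('a \<Rightarrow> 'a) \<Rightarrow> bool" where
  "kolmogorov M T \<longleftrightarrow>
     (\<forall>F. factor_algebra M T F \<and> ks_entropy (restr_to_subalg M F) T = 0 \<longrightarrow> trivial_factor M F)"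


section \<open>Markov operators and Markov quasi-similarity\<close>

text \<open>
  The complex space \<open>L\<^sup>2(M)\<close> is handled through representatives: its elements are the
  square-integrable functions, with equality almost everywhere. An operator acts on representatives
  and is required to respect that equality; all identities between its values hold
  almost everywhere.
\<close>

definition L2 :: "'a measure \<Rightarrow> ('a \<Rightarrow> complex) set" where
  "L2 M = {f \<in> borel_measurable M. integrable M (\<lambda>x. (cmod (f x))\<^sup>2)}"

definition L2_inner :: "'a measure \<Rightarrow> ('a \<Rightarrow> complex) \<Rightarrow> ('a \<Rightarrow> complex) \<Rightarrow> complex" where
  "L2_inner M f g = (LINT x|M. f x * cnj (g x))"

definition L2_norm :: "'a measure \<Rightarrow> ('a \<Rightarrow> complex) \<Rightarrow> real" where
  "L2_norm M f = sqrt (LINT x|M. (cmod (f x))\<^sup>2)"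

definition L2_operator ::
  "'a measure \<Rightarrow> 'b measure \<Rightarrow> (('a \<Rightarrow> complex) \<Rightarrow> ('b \<Rightarrow> complex)) \<Rightarrow> bool" where
  "L2_operator M N \<Phi> \<longleftrightarrow>
     (\<forall>f\<in>L2 M. \<Phi> f \<in> L2 N) \<and>
     (\<forall>f\<in>L2 M. \<forall>g\<in>L2 M. (AE x in M. f x = g x) \<longrightarrow> (AE y in N. \<Phi> f y = \<Phi> g y)) \<and>
     (\<forall>f\<in>L2 M. \<forall>g\<in>L2 M. AE y in N. \<Phi> (\<lambda>x. f x + g x) y = \<Phi> f y + \<Phi> g y) \<and>
     (\<forall>c. \<forall>f\<in>L2 M. AE y in N. \<Phi> (\<lambda>x. c * f x) y = c * \<Phi> f y)"

definition L2_adjoint ::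
  "'a measure \<Rightarrow> 'b measure \<Rightarrow> (('a \<Rightarrow> complex) \<Rightarrow> ('b \<Rightarrow> complex)) \<Rightarrow>
     (('b \<Rightarrow> complex) \<Rightarrow> ('a \<Rightarrow> complex)) \<Rightarrow> bool" where
  "L2_adjoint M N \<Phi> \<Psi> \<longleftrightarrow>
     L2_operator N M \<Psi> \<and> (\<forall>f\<in>L2 M. \<forall>g\<in>L2 N. L2_inner N (\<Phi> f) g = L2_inner M f (\<Psi> g))"

text \<open>
  The adjoint of a bounded operator exists and is unique up to equality almost everywhere, so the
  existential quantifier below refers to the adjoint of \<open>\<Phi>\<close>.
\<close>

definition markov_operator ::
  "'a measure \<Rightarrow> 'b measure \<Rightarrow> (('a \<Rightarrow> complex) \<Rightarrow> ('b \<Rightarrow> complex)) \<Rightarrow> bool" where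
  "markov_operator M N \<Phi> \<longleftrightarrow>
     L2_operator M N \<Phi> \<and>
     (\<forall>f\<in>L2 M. L2_norm N (\<Phi> f) \<le> L2_norm M f) \<and>
     (\<forall>f\<in>L2 M. (AE x in M. f x \<in> nonneg_Reals) \<longrightarrow> (AE y in N. \<Phi> f y \<in> nonneg_Reals)) \<and>
     (AE y in N. \<Phi> (\<lambda>x. 1) y = 1) \<and>
     (\<exists>\<Psi>. L2_adjoint M N \<Phi> \<Psi> \<and> (AE x in M. \<Psi> (\<lambda>y. 1) x = 1))"

definition koopman :: "('a \<Rightarrow> 'a) \<Rightarrow> ('a \<Rightarrow> complex) \<Rightarrow> ('a \<Rightarrow> complex)" where
  "koopman T f = f \<circ> T"

definition L2_dense_range ::
  "'a measure \<Rightarrow> 'b measure \<Rightarrow> (('a \<Rightarrow> complex) \<Rightarrow> ('b \<Rightarrow> complex)) \<Rightarrow> bool" where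
  "L2_dense_range M N \<Phi> \<longleftrightarrow>
     (\<forall>g\<in>L2 N. \<forall>\<epsilon>>0. \<exists>f\<in>L2 M. L2_norm N (\<lambda>y. \<Phi> f y - g y) < \<epsilon>)"

definition markov_quasi_image ::
  "'a measure \<Rightarrow> ('a \<Rightarrow> 'a) \<Rightarrow> 'b measure \<Rightarrow> ('b \<Rightarrow> 'b) \<Rightarrow> bool"
  \<comment> \<open>\<open>T2\<close> on \<open>M2\<close> is a Markov quasi-image of \<open>T1\<close> on \<open>M1\<close>\<close>
  where
  "markov_quasi_image M2 T2 M1 T1 \<longleftrightarrow>
     (\<exists>\<Phi>. markov_operator M1 M2 \<Phi> \<and> L2_dense_range M1 M2 \<Phi> \<and>
          (\<forall>f\<in>L2 M1. AE y in M2. \<Phi> (koopman T1 f) y = koopman T2 (\<Phi> f) y))"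

definition markov_quasi_similar ::
  "'a measure \<Rightarrow> ('a \<Rightarrow> 'a) \<Rightarrow> 'b measure \<Rightarrow> ('b \<Rightarrow> 'b) \<Rightarrow> bool" where
  "markov_quasi_similar M1 T1 M2 T2 \<longleftrightarrow>
     markov_quasi_image M2 T2 M1 T1 \<and> markov_quasi_image M1 T1 M2 T2"

end

(*
  Let Phi intertwine T1 with T2, let F be a zero-entropy factor of T2, and let Q be in F. It suffices
  that the adjoint Psi maps 1_Q to a constant g: then 1_Q - mu2(Q) is orthogonal to the range of Phi,
  which is dense, so mu2(Q) is 0 or 1.

  Given a point x of the first space, draw m independent points y_1, ..., y_m of the second one whose
  itineraries with respect to Q have conditional probabilities Psi 1_R (x), where R runs through the
  itinerary atoms. By the law of large numbers, the frequency of Q among T2^i y_1, ..., T2^i y_m is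
  close to g (T1^i x), so that, for all but countably many c, it decides whether g (T1^i x) > c except
  on an event of small probability. The n-itinerary of x with respect to {g > c} is therefore a
  function of m itineraries, whose entropies are o(n), and of n events of small entropy. Hence {g > c}
  lies in the Pinsker algebra of T1, which is a zero-entropy factor. As T1 is Kolmogorov, it is
  trivial, and g is constant.
*)
theory Submission
  imports Defs "HOL-Real_Asymp.Real_Asymp"
begin

section \<open>Entropy of finite partitions\<close>

text \<open>The conditional probability g takes values between 0 and 1 and is in general no
  indicator, so a single point y cannot reveal whether g exceeds c; averaging over independent
  points can. A whole n-itinerary is drawn as one label. Then m draws cost at most m times an
  entropy that is o(n), whereas fresh draws at each time would cost a multiple of n. The order of
  the choices matters: \<epsilon> fixes the admissible probability \<delta> of an error at one time,
  since the n error events together may cost n \<epsilon> / 2; \<delta> fixes a band around c that g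
  rarely meets; the width of the band fixes the number m of draws, through a variance bound uniform
  in the point and the time; n comes last. A level c that g attains with positive probability admits
  no such band, and there are only countably many of these. Since only finitely many itinerary atoms
  occur at a time, the draws live on the product of the first space with a finite set, and
  identities that hold almost everywhere suffice.\<close>

lemma information_space_exp_1: "prob_space M \<Longrightarrow> information_space M (exp 1)"
  by (simp add: information_space_def information_space_axioms_def)

text \<open>A value that is not attained has probability 0 and contributes 0, so the sum may run
  over any finite superset of the range. Two variables with different ranges can then be compared
  term by term.\<close>

lemma partition_entropy_eq_sum:
  assumes "prob_space M" "simple_function M X" "finite S" "X ` space M \<subseteq> S"
  shows "partition_entropy M X =
    - (\<Sum>v\<in>S. measure M (X -` {v} \<inter> space M) * ln (measure M (X -` {v} \<inter> space M)))"
proof -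
  interpret information_space M "exp 1" using assms(1) by (rule information_space_exp_1)
  have "partition_entropy M X =
    - (\<Sum>v\<in>X ` space M. prob (X -` {v} \<inter> space M) * ln (prob (X -` {v} \<inter> space M)))"
    unfolding partition_entropy_def
    by (subst entropy_simple_distributed[OF simple_distributedI[OF assms(2) measure_nonneg refl]])
       (simp add: log_def)
  also have "(\<Sum>v\<in>X ` space M. prob (X -` {v} \<inter> space M) * ln (prob (X -` {v} \<inter> space M)))
    = (\<Sum>v\<in>S. prob (X -` {v} \<inter> space M) * ln (prob (X -` {v} \<inter> space M)))"
  proof (intro sum.mono_neutral_left ballI)
    fix v assume "v \<in> S - X ` space M"
    then have "X -` {v} \<inter> space M = {}" by auto
    then show "prob (X -` {v} \<inter> space M) * ln (prob (X -` {v} \<inter> space M)) = 0" by simp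
  qed (use assms in auto)
  finally show ?thesis .
qed

text \<open>Entropy depends only on the law. This carries it between different spaces: along
  iterates of the automorphism, to a sub-sigma-algebra, and to the space of copies.\<close>

lemma partition_entropy_cong_distribution:
  assumes "prob_space M" "simple_function M X" "prob_space N" "simple_function N Y"
    and "\<And>v. measure M (X -` {v} \<inter> space M) = measure N (Y -` {v} \<inter> space N)"
  shows "partition_entropy M X = partition_entropy N Y"
proof -
  have "finite (X ` space M \<union> Y ` space N)" using assms by (auto simp: simple_function_def)
  then show ?thesis
    using partition_entropy_eq_sum[OF assms(1,2), of "X ` space M \<union> Y ` space N"]
      partition_entropy_eq_sum[OF assms(3,4), of "X ` space M \<union> Y ` space N"] assms(5) by simp
qed

lemma partition_entropy_nonneg:
  assumes "prob_space M" "simple_function M X"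
  shows "0 \<le> partition_entropy M X"
proof -
  interpret prob_space M by fact
  have "partition_entropy M X =
    - (\<Sum>v\<in>X ` space M. prob (X -` {v} \<inter> space M) * ln (prob (X -` {v} \<inter> space M)))"
    using assms by (intro partition_entropy_eq_sum) (auto simp: simple_function_def)
  moreover have "t * ln t \<le> 0" if "0 \<le> t" "t \<le> 1" for t :: real
    using that by (cases "t = 0") (auto intro!: mult_nonneg_nonpos)
  ultimately show ?thesis by (simp add: sum_nonpos)
qed

lemma partition_entropy_le:
  assumes "prob_space M" "simple_function M X" "simple_function M Y"
    and "\<And>x. x \<in> space M \<Longrightarrow> X x = f (Y x)"
  shows "partition_entropy M X \<le> partition_entropy M Y"
proof -
  interpret information_space M "exp 1" using assms(1) by (rule information_space_exp_1)
  \<comment> \<open>\<open>X\<close> and \<open>f \<circ> Y\<close> agree only on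
    \<open>space M\<close>; equality of laws absorbs the difference before data processing is
    applied.\<close>
  have "partition_entropy M X = partition_entropy M (f \<circ> Y)"
    using assms by (intro partition_entropy_cong_distribution arg_cong[where f = prob]
        simple_function_compose) auto
  then show ?thesis
    using entropy_data_processing[OF assms(3), of f] unfolding partition_entropy_def by simp
qed

lemma partition_entropy_Pair:
  assumes "prob_space M" "simple_function M X" "simple_function M Y"
  shows "partition_entropy M (\<lambda>x. (X x, Y x)) \<le> partition_entropy M X + partition_entropy M Y"
proof -
  interpret information_space M "exp 1" using assms(1) by (rule information_space_exp_1)
  show ?thesis
    using entropy_chain_rule[OF assms(2,3)] conditional_entropy_less_eq_entropy[OF assms(3,2)]
    unfolding partition_entropy_def by simp
qed

text \<open>As \<open>f\<close> is arbitrary, any code that reconstructs \<open>Z\<close> from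
  \<open>X\<close> and \<open>Y\<close> yields an entropy bound. All later estimates are made in
  this way.\<close>

lemma partition_entropy_le_add:
  assumes "prob_space M" "simple_function M X" "simple_function M Y" "simple_function M Z"
    and "\<And>x. x \<in> space M \<Longrightarrow> Z x = f (X x) (Y x)"
  shows "partition_entropy M Z \<le> partition_entropy M X + partition_entropy M Y"
  using partition_entropy_le[of M Z "\<lambda>x. (X x, Y x)" "\<lambda>(a, b). f a b"]
    partition_entropy_Pair[of M X Y] assms by fastforce

lemma simple_function_map:
  assumes "\<And>i. i \<in> set is \<Longrightarrow> simple_function M (X i)"
  shows "simple_function M (\<lambda>x. map (\<lambda>i. X i x) is)"
  using assms
proof (induction "is")
  case (Cons i "is")
  then have "simple_function M ((\<lambda>(a, b). a # b) \<circ> (\<lambda>x. (X i x, map (\<lambda>i. X i x) is)))"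
    by (intro simple_function_compose simple_function_Pair) auto
  then show ?case by (simp add: comp_def)
qed simp

lemma partition_entropy_map:
  fixes X :: "'i \<Rightarrow> 'a \<Rightarrow> 'c"
  assumes "prob_space M" "\<And>i. i \<in> set is \<Longrightarrow> simple_function M (X i)"
  shows "partition_entropy M (\<lambda>x. map (\<lambda>i. X i x) is) \<le> (\<Sum>i\<leftarrow>is. partition_entropy M (X i))"
  using assms(2)
proof (induction "is")
  case Nil
  interpret prob_space M by fact
  have "partition_entropy M (\<lambda>x. [] :: 'c list) = - (\<Sum>v\<in>{[] :: 'c list}.
    prob ((\<lambda>x. []) -` {v} \<inter> space M) * ln (prob ((\<lambda>x. []) -` {v} \<inter> space M)))"
    using assms(1) by (intro partition_entropy_eq_sum) auto
  also have "\<dots> = 0" by (simp add: prob_space)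
  finally show ?case by simp
next
  case (Cons i "is")
  have map: "simple_function M (\<lambda>x. map (\<lambda>i. X i x) (i # is))"
    using Cons.prems by (rule simple_function_map)
  have "partition_entropy M (\<lambda>x. map (\<lambda>i. X i x) (i # is))
    \<le> partition_entropy M (X i) + partition_entropy M (\<lambda>x. map (\<lambda>i. X i x) is)"
    by (rule partition_entropy_le_add[where f = "(#)"])
       (use Cons.prems assms(1) map in \<open>auto intro: simple_function_map\<close>)
  then show ?case using Cons by fastforce
qed

lemma simple_function_mem: "A \<in> sets M \<Longrightarrow> simple_function M (\<lambda>x. x \<in> A)"
  by (auto simp: simple_function_def vimage_def Int_def[symmetric] conj_commute
      intro: finite_subset[of _ UNIV])

text \<open>The binary entropy tends to 0 at 0. The same \<open>\<delta>\<close> serves all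
  probability spaces on the type, because the space of copies to which it is applied is built only
  after \<open>\<delta>\<close> is fixed.\<close>

lemma partition_entropy_small_event:
  assumes "0 < \<epsilon>"
  obtains \<delta> where "0 < \<delta>"
    "\<And>M A. prob_space M \<Longrightarrow> A \<in> sets M \<Longrightarrow> measure M A \<le> \<delta> \<Longrightarrow> partition_entropy M (\<lambda>x. x \<in> A) \<le> \<epsilon>"
proof -
  have "((\<lambda>t::real. - (t * ln t) - (1 - t) * ln (1 - t)) \<longlongrightarrow> 0) (at_right 0)"
    by real_asymp
  then have "\<forall>\<^sub>F t in at_right 0. - (t * ln t) - (1 - t) * ln (1 - t) < \<epsilon>"
    using assms by (auto dest: order_tendstoD(2))
  then obtain d :: real where d: "d > 0" "\<And>t. 0 < t \<Longrightarrow> t < d \<Longrightarrow> - (t * ln t) - (1 - t) * ln (1 - t) < \<epsilon>"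
    unfolding eventually_at_right_field by auto
  have "partition_entropy M (\<lambda>x. x \<in> A) \<le> \<epsilon>"
    if M: "prob_space M" and A: "A \<in> sets M" "measure M A \<le> d / 2" for M :: "'a measure" and A
  proof -
    interpret prob_space M by fact
    have *: "(\<lambda>x. x \<in> A) -` {True} \<inter> space M = A" "(\<lambda>x. x \<in> A) -` {False} \<inter> space M = space M - A"
      using sets.sets_into_space[OF A(1)] by auto
    have "partition_entropy M (\<lambda>x. x \<in> A) =
      - (prob A * ln (prob A)) - (1 - prob A) * ln (1 - prob A)"
      using partition_entropy_eq_sum[OF M simple_function_mem[OF A(1)] finite_class.finite_UNIV subset_UNIV] A(1)
      by (simp add: UNIV_bool * prob_compl algebra_simps)
    \<comment> \<open>The limit is taken from the right and says nothing at 0, hence the separate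
      case of a null event.\<close>
    also have "\<dots> \<le> \<epsilon>"
      using d(1) d(2)[of "prob A"] A(2) assms by (cases "prob A = 0") (auto simp: zero_less_measure_iff)
    finally show ?thesis .
  qed
  with d(1) show ?thesis by (intro that[of "d / 2"]) auto
qed

section \<open>Entropy along an automorphism\<close>

lemma mp_automorphism_prob_space: "mp_automorphism M T \<Longrightarrow> prob_space M"
  by (simp add: mp_automorphism_def)

lemma mp_automorphism_measurable: "mp_automorphism M T \<Longrightarrow> T \<in> M \<rightarrow>\<^sub>M M"
  by (simp add: mp_automorphism_def)

lemma funpow_measurable: "mp_automorphism M T \<Longrightarrow> T ^^ i \<in> M \<rightarrow>\<^sub>M M"
  by (intro measurable_compose_n mp_automorphism_measurable)

lemma funpow_distr:
  assumes "mp_automorphism M T"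
  shows "distr M M (T ^^ i) = M"
proof (induction i)
  case (Suc i)
  have "distr M M (T \<circ> T ^^ i) = distr (distr M M (T ^^ i)) M T"
    using mp_automorphism_measurable[OF assms] funpow_measurable[OF assms]
    by (simp add: distr_distr)
  then show ?case using Suc assms by (simp add: mp_automorphism_def comp_def)
qed (simp add: id_def distr_id)

lemma measure_funpow:
  assumes "mp_automorphism M T" "A \<in> sets M"
  shows "measure M ((T ^^ i) -` A \<inter> space M) = measure M A"
  using measure_distr[OF funpow_measurable[OF assms(1), of i], of A] assms
  by (simp add: funpow_distr)

lemma simple_function_funpow:
  assumes "mp_automorphism M T" "simple_function M p"
  shows "simple_function M (\<lambda>x. p ((T ^^ i) x))"
  using simple_function_comp[OF funpow_measurable[OF assms(1)] assms(2)] by (simp add: comp_def)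

lemma partition_entropy_funpow:
  assumes "mp_automorphism M T" "simple_function M p"
  shows "partition_entropy M (\<lambda>x. p ((T ^^ i) x)) = partition_entropy M p"
proof (intro partition_entropy_cong_distribution mp_automorphism_prob_space[OF assms(1)]
    simple_function_funpow assms)
  fix v
  have "(\<lambda>x. p ((T ^^ i) x)) -` {v} \<inter> space M = (T ^^ i) -` (p -` {v} \<inter> space M) \<inter> space M"
    using measurable_space[OF funpow_measurable[OF assms(1)]] by auto
  then show "measure M ((\<lambda>x. p ((T ^^ i) x)) -` {v} \<inter> space M) = measure M (p -` {v} \<inter> space M)"
    using measure_funpow[OF assms(1) simple_functionD(2)[OF assms(2)]] by simp
qed

lemma simple_function_itinerary:
  "mp_automorphism M T \<Longrightarrow> simple_function M p \<Longrightarrow> simple_function M (itinerary T p n)"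
  unfolding itinerary_def[abs_def] by (intro simple_function_map simple_function_funpow)

lemma itinerary_add: "itinerary T p (m + n) x = itinerary T p m x @ itinerary T p n ((T ^^ m) x)"
  unfolding itinerary_def
  by (intro nth_equalityI) (auto simp: nth_append funpow_add[symmetric, unfolded comp_def, THEN fun_cong])

lemma partition_entropy_itinerary_add:
  assumes "mp_automorphism M T" "simple_function M p"
  shows "partition_entropy M (itinerary T p (m + n))
    \<le> partition_entropy M (itinerary T p m) + partition_entropy M (itinerary T p n)"
proof -
  have "partition_entropy M (itinerary T p (m + n))
    \<le> partition_entropy M (itinerary T p m) + partition_entropy M (\<lambda>x. itinerary T p n ((T ^^ m) x))"
    using assms
    by (intro partition_entropy_le_add[where f = "(@)"])
      (auto simp: itinerary_add mp_automorphism_prob_space intro: simple_function_itinerary simple_function_funpow)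
  then show ?thesis
    using assms by (simp add: partition_entropy_funpow simple_function_itinerary)
qed

section \<open>Subadditive sequences and partitions of zero entropy\<close>

lemma Fekete:
  fixes a :: "nat \<Rightarrow> real"
  assumes sub: "\<And>m n. a (m + n) \<le> a m + a n" and nonneg: "\<And>n. 0 \<le> a n"
  shows "(\<lambda>n. a n / real n) \<longlonglongrightarrow> (INF n\<in>{1..}. a n / real n)"
proof (rule LIMSEQ_I)
  fix \<epsilon> :: real assume e: "0 < \<epsilon>"
  \<comment> \<open>The infimum starts at 1: at 0 the quotient is 0 by convention and would force
    the infimum to be 0.\<close>
  define L where "L = (INF n\<in>{1..}. a n / real n)"
  have bdd: "bdd_below ((\<lambda>n. a n / real n) ` {1..})"
    by (intro bdd_belowI[where m = 0]) (auto simp: nonneg)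
  have "\<exists>k\<in>{1..}. a k / real k < L + \<epsilon> / 2"
    unfolding L_def using e by (intro iffD1[OF cINF_less_iff[OF _ bdd]]) auto
  then obtain k where k: "1 \<le> k" "a k / real k < L + \<epsilon> / 2" by auto
  \<comment> \<open>Division with remainder: a length n splits into blocks of the nearly optimal
    length \<open>k\<close> and a remainder whose cost is bounded independently of n.\<close>
  have mult: "a (q * k + r) \<le> real q * a k + a r" for q r
  proof (induction q)
    case (Suc q)
    have "a (Suc q * k + r) \<le> a k + a (q * k + r)" using sub[of k "q * k + r"] by (simp add: add.assoc)
    then show ?case using Suc by (simp add: algebra_simps)
  qed simp
  define C where "C = Max (a ` {..<k})"
  have C: "a r \<le> C" if "r < k" for r unfolding C_def using that by auto
  have "C \<ge> 0" using C[of 0] nonneg[of 0] k(1) by simp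
  obtain N :: nat where N: "real N > 2 * C / \<epsilon>" using reals_Archimedean2 by blast
  have "norm (a n / real n - L) < \<epsilon>" if n: "n \<ge> max 1 N" for n
  proof -
    have n0: "real n > 0" using n by simp
    have "a n \<le> real (n div k) * a k + a (n mod k)" using mult[of "n div k" "n mod k"] by simp
    also have "\<dots> \<le> (real n / real k) * a k + C"
      using k(1) by (intro add_mono mult_right_mono C nonneg of_nat_div_le_of_nat) auto
    finally have "a n / real n \<le> a k / real k + C / real n"
      using n0 by (simp add: field_simps)
    moreover have "C / real n < \<epsilon> / 2"
    proof -
      have "2 * C / \<epsilon> < real n" using N n by linarith
      then show ?thesis using n0 e by (simp add: field_simps)
    qed
    moreover have "L \<le> a n / real n" unfolding L_def using n by (intro cINF_lower[OF bdd]) auto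
    ultimately show ?thesis using k(2) by (simp only: real_norm_def abs_less_iff) linarith
  qed
  then show "\<exists>no. \<forall>n\<ge>no. norm (a n / real n - (INF n\<in>{1..}. a n / real n)) < \<epsilon>"
    unfolding L_def by blast
qed

lemma itinerary_entropy_tendsto:
  assumes "mp_automorphism M T" "simple_function M p"
  shows "(\<lambda>n. partition_entropy M (itinerary T p n) / real n) \<longlonglongrightarrow> entropy_of_partition M T p"
proof -
  have "convergent (\<lambda>n. partition_entropy M (itinerary T p n) / real n)"
    using Fekete[of "\<lambda>n. partition_entropy M (itinerary T p n)"] assms
    by (auto intro!: convergentI partition_entropy_itinerary_add partition_entropy_nonneg
        mp_automorphism_prob_space simple_function_itinerary)
  then show ?thesis unfolding entropy_of_partition_def by (simp add: convergent_LIMSEQ_iff)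
qed

text \<open>
  One good \<open>n\<close> for each \<open>\<epsilon>\<close> suffices, because by Fekete's lemma the limit of the normalised entropies
  is their infimum.
\<close>

definition zero_entropy :: "'a measure \<Rightarrow> ('a \<Rightarrow> 'a) \<Rightarrow> ('a \<Rightarrow> 'c) \<Rightarrow> bool" where
  "zero_entropy M T p \<longleftrightarrow>
     (\<forall>\<epsilon>>0. \<exists>n>0. partition_entropy M (itinerary T p n) \<le> \<epsilon> * real n)"

lemma zero_entropy_iff:
  assumes "mp_automorphism M T" "simple_function M p"
  shows "zero_entropy M T p \<longleftrightarrow> entropy_of_partition M T p = 0"
proof -
  let ?a = "\<lambda>n. partition_entropy M (itinerary T p n)"
  have nonneg: "?a n \<ge> 0" for n
    using assms by (intro partition_entropy_nonneg mp_automorphism_prob_space simple_function_itinerary)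
  have bdd: "bdd_below ((\<lambda>n. ?a n / real n) ` {1..})"
    by (intro bdd_belowI[where m = 0]) (auto simp: nonneg)
  have eq: "entropy_of_partition M T p = (INF n\<in>{1..}. ?a n / real n)"
    using Fekete[of ?a] itinerary_entropy_tendsto[OF assms] nonneg
      partition_entropy_itinerary_add[OF assms] by (blast intro: LIMSEQ_unique)
  have ge: "entropy_of_partition M T p \<ge> 0"
    unfolding eq by (intro cINF_greatest) (auto simp: nonneg)
  have "zero_entropy M T p \<longleftrightarrow> (\<forall>\<epsilon>>0. \<exists>n\<in>{1..}. ?a n / real n \<le> \<epsilon>)"
    unfolding zero_entropy_def
    by (intro all_cong1 imp_cong refl) (auto simp: Bex_def Suc_le_eq pos_divide_le_eq)
  also have "\<dots> \<longleftrightarrow> (\<forall>\<epsilon>>0. \<exists>n\<in>{1..}. ?a n / real n < \<epsilon>)"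
    by (meson dense less_imp_le order_le_less_trans)
  also have "\<dots> \<longleftrightarrow> (\<forall>\<epsilon>>0. entropy_of_partition M T p < \<epsilon>)"
    unfolding eq by (subst cINF_less_iff[OF _ bdd]) auto
  also have "\<dots> \<longleftrightarrow> entropy_of_partition M T p = 0"
    using ge by (metis less_irrefl order_le_less)
  finally show ?thesis .
qed

text \<open>The normalised entropies converge, so one good length for each \<open>\<epsilon>\<close>
  makes all large lengths good. Two partitions can therefore be given a common length.\<close>

lemma zero_entropy_eventually:
  assumes "mp_automorphism M T" "simple_function M p" "zero_entropy M T p" "0 < \<epsilon>"
  shows "\<forall>\<^sub>F n in sequentially. partition_entropy M (itinerary T p n) \<le> \<epsilon> * real n"
proof -
  have "(\<lambda>n. partition_entropy M (itinerary T p n) / real n) \<longlonglongrightarrow> 0"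
    using itinerary_entropy_tendsto[OF assms(1,2)] zero_entropy_iff[OF assms(1,2)] assms(3) by simp
  then have "\<forall>\<^sub>F n in sequentially. partition_entropy M (itinerary T p n) / real n < \<epsilon>"
    using assms(4) by (rule order_tendstoD)
  then show ?thesis
    using eventually_gt_at_top[of 0] by eventually_elim (auto simp: field_simps)
qed

section \<open>The Pinsker algebra\<close>

lemma partition_entropy_itinerary_le:
  assumes "mp_automorphism M T" "simple_function M p"
  shows "partition_entropy M (itinerary T p n) \<le> real n * partition_entropy M p"
proof -
  have "partition_entropy M (itinerary T p n)
    \<le> (\<Sum>i\<leftarrow>[0..<n]. partition_entropy M (\<lambda>x. p ((T ^^ i) x)))"
    unfolding itinerary_def[abs_def] using assms
    by (intro partition_entropy_map mp_automorphism_prob_space[OF assms(1)] simple_function_funpow)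
  then show ?thesis
    using assms by (simp add: partition_entropy_funpow sum_list_triv)
qed

lemma funpow_space: "mp_automorphism M T \<Longrightarrow> x \<in> space M \<Longrightarrow> (T ^^ i) x \<in> space M"
  using measurable_space[OF funpow_measurable] .

lemma partition_entropy_itinerary_le_add:
  assumes T: "mp_automorphism M T" and simple: "simple_function M p" "simple_function M q" "simple_function M r"
    and r: "\<And>x. x \<in> space M \<Longrightarrow> r x = f (p x) (q x)"
  shows "partition_entropy M (itinerary T r n)
    \<le> partition_entropy M (itinerary T p n) + partition_entropy M (itinerary T q n)"
proof (intro partition_entropy_le_add[where f = "\<lambda>us vs. map2 f us vs"]
    mp_automorphism_prob_space[OF T] simple_function_itinerary T simple)
  fix x assume "x \<in> space M"
  then show "itinerary T r n x = map2 f (itinerary T p n x) (itinerary T q n x)"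
    unfolding itinerary_def by (intro nth_equalityI) (auto simp: r funpow_space[OF T])
qed

lemma zero_entropy_determined:
  assumes T: "mp_automorphism M T" and simple: "simple_function M p" "simple_function M q" "simple_function M r"
    and zero: "zero_entropy M T p" "zero_entropy M T q"
    and r: "\<And>x. x \<in> space M \<Longrightarrow> r x = f (p x) (q x)"
  shows "zero_entropy M T r"
  unfolding zero_entropy_def
proof (intro allI impI)
  fix \<epsilon> :: real assume "0 < \<epsilon>"
  then have "\<forall>\<^sub>F n in sequentially. partition_entropy M (itinerary T p n) \<le> \<epsilon> / 2 * real n \<and>
      partition_entropy M (itinerary T q n) \<le> \<epsilon> / 2 * real n \<and> 0 < n"
    using zero_entropy_eventually[OF T simple(1) zero(1), of "\<epsilon> / 2"]
      zero_entropy_eventually[OF T simple(2) zero(2), of "\<epsilon> / 2"] eventually_gt_at_top[of 0]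
    by (intro eventually_conj) auto
  then obtain n where "partition_entropy M (itinerary T p n) \<le> \<epsilon> / 2 * real n"
      "partition_entropy M (itinerary T q n) \<le> \<epsilon> / 2 * real n" "0 < n"
    using eventually_happens'[OF sequentially_bot] by blast
  then show "\<exists>n>0. partition_entropy M (itinerary T r n) \<le> \<epsilon> * real n"
    using partition_entropy_itinerary_le_add[OF T simple r, of n]
    by (intro exI[of _ n]) (auto simp: field_simps)
qed

lemma zero_entropy_compose:
  assumes "mp_automorphism M T" "simple_function M p" "simple_function M q" "zero_entropy M T p"
    and "\<And>x. x \<in> space M \<Longrightarrow> q x = f (p x)"
  shows "zero_entropy M T q"
  using assms by (intro zero_entropy_determined[of M T p p q "\<lambda>a b. f a"])

text \<open>The itinerary of \<open>p \<circ> T\<close> is that of \<open>p\<close> started one step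
  later, so stationarity equates the entropies. This makes the Pinsker algebra invariant under
  \<open>T\<close> and its inverse.\<close>

lemma zero_entropy_shift:
  assumes "mp_automorphism M T" "simple_function M p"
  shows "zero_entropy M T (\<lambda>x. p (T x)) \<longleftrightarrow> zero_entropy M T p"
proof -
  have "itinerary T (\<lambda>x. p (T x)) n = (\<lambda>x. itinerary T p n ((T ^^ 1) x))" for n
    by (simp add: itinerary_def fun_eq_iff funpow_swap1)
  then have "partition_entropy M (itinerary T (\<lambda>x. p (T x)) n) = partition_entropy M (itinerary T p n)" for n
    using assms by (simp only: partition_entropy_funpow simple_function_itinerary)
  then show ?thesis by (simp add: zero_entropy_def)
qed

lemma zero_entropy_null_set:
  assumes T: "mp_automorphism M T" and A: "A \<in> sets M" "measure M A = 0"
  shows "zero_entropy M T (\<lambda>x. x \<in> A)"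
  unfolding zero_entropy_def
proof (intro allI impI)
  fix \<epsilon> :: real assume "0 < \<epsilon>"
  then obtain \<delta> where "0 < \<delta>" "\<And>(M :: 'a measure) A. prob_space M \<Longrightarrow> A \<in> sets M \<Longrightarrow> measure M A \<le> \<delta> \<Longrightarrow>
      partition_entropy M (\<lambda>x. x \<in> A) \<le> \<epsilon>"
    using partition_entropy_small_event by blast
  then have "partition_entropy M (\<lambda>x. x \<in> A) \<le> \<epsilon>"
    using A mp_automorphism_prob_space[OF T] by simp
  then show "\<exists>n>0. partition_entropy M (itinerary T (\<lambda>x. x \<in> A) n) \<le> \<epsilon> * real n"
    using partition_entropy_itinerary_le[OF T simple_function_mem[OF A(1)], of 1]
    by (intro exI[of _ 1]) auto
qed

text \<open>Only two-set partitions enter here; \<open>zero_entropy_pinsker_measurable\<close>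
  recovers all finite partitions with atoms in this family.\<close>

definition pinsker :: "'a measure \<Rightarrow> ('a \<Rightarrow> 'a) \<Rightarrow> 'a set set" where
  "pinsker M T = {A \<in> sets M. zero_entropy M T (\<lambda>x. x \<in> A)}"

lemma pinsker_Un:
  assumes "mp_automorphism M T" "A \<in> pinsker M T" "B \<in> pinsker M T"
  shows "A \<union> B \<in> pinsker M T"
proof -
  have *: "A \<in> sets M" "B \<in> sets M" "A \<union> B \<in> sets M" "zero_entropy M T (\<lambda>x. x \<in> A)"
      "zero_entropy M T (\<lambda>x. x \<in> B)"
    using assms by (auto simp: pinsker_def)
  have "zero_entropy M T (\<lambda>x. x \<in> A \<union> B)"
    by (rule zero_entropy_determined[OF assms(1) *(1-3)[THEN simple_function_mem] *(4,5),
          where f = "(\<or>)"]) simp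
  then show ?thesis using * by (simp add: pinsker_def)
qed

lemma pinsker_finite_UN:
  assumes "mp_automorphism M T" "\<And>i :: nat. A i \<in> pinsker M T"
  shows "(\<Union>i<m. A i) \<in> pinsker M T"
proof (induction m)
  case 0
  show ?case using zero_entropy_null_set[OF assms(1), of "{}"] by (simp add: pinsker_def)
next
  case (Suc m)
  then show ?case using pinsker_Un[OF assms(1) assms(2)[of m]] by (simp add: lessThan_Suc)
qed

text \<open>A finite subunion has zero entropy, and what it misses is an event of small probability.
  Paying for that event at each of n times costs at most n \<epsilon> / 2, whatever n is, so the
  subunion can be fixed before n.\<close>

lemma pinsker_countable_UN:
  assumes T: "mp_automorphism M T" and A: "\<And>i :: nat. A i \<in> pinsker M T"
  shows "(\<Union>i. A i) \<in> pinsker M T"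
proof -
  interpret prob_space M using T by (rule mp_automorphism_prob_space)
  define U where "U = (\<Union>i. A i)"
  define B where "B m = (\<Union>i<m. A i)" for m
  have A_sets: "A i \<in> sets M" for i using A by (simp add: pinsker_def)
  have U: "U \<in> sets M" and B: "B m \<in> sets M" for m
    unfolding U_def B_def using A_sets by auto
  have BU: "B m \<subseteq> U" for m by (auto simp: U_def B_def)
  have "(\<lambda>m. prob (B m)) \<longlonglongrightarrow> prob (\<Union>m. B m)"
    by (intro finite_Lim_measure_incseq) (use B in \<open>auto simp: incseq_def B_def dest: less_le_trans\<close>)
  moreover have "(\<Union>m. B m) = U" by (auto simp: U_def B_def)
  ultimately have lim: "(\<lambda>m. prob (U - B m)) \<longlonglongrightarrow> 0"
    using tendsto_diff[OF tendsto_const[of "prob U"], of "\<lambda>m. prob (B m)" "prob U"] B U BU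
    by (simp add: finite_measure_Diff)
  have "zero_entropy M T (\<lambda>x. x \<in> U)"
    unfolding zero_entropy_def
  proof (intro allI impI)
    fix \<epsilon> :: real assume "0 < \<epsilon>"
    then have "0 < \<epsilon> / 2" by simp
    then obtain \<delta> where \<delta>: "0 < \<delta>" "\<And>(M :: 'a measure) A. prob_space M \<Longrightarrow> A \<in> sets M \<Longrightarrow> measure M A \<le> \<delta> \<Longrightarrow>
        partition_entropy M (\<lambda>x. x \<in> A) \<le> \<epsilon> / 2"
      using partition_entropy_small_event by blast
    have "\<forall>\<^sub>F m in sequentially. prob (U - B m) < \<delta>"
      using lim \<delta>(1) by (rule order_tendstoD)
    then obtain m where "prob (U - B m) < \<delta>"
      using eventually_happens'[OF sequentially_bot] by blast
    then have D: "partition_entropy M (\<lambda>x. x \<in> U - B m) \<le> \<epsilon> / 2"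
      using U B prob_space_axioms by (intro \<delta>(2)) auto
    have UB: "U - B m \<in> sets M" using U B by auto
    have "zero_entropy M T (\<lambda>x. x \<in> B m)"
      using pinsker_finite_UN[of M T A, OF T A] by (simp add: pinsker_def B_def)
    then obtain n where n: "0 < n" "partition_entropy M (itinerary T (\<lambda>x. x \<in> B m) n) \<le> \<epsilon> / 2 * real n"
      unfolding zero_entropy_def using \<open>0 < \<epsilon> / 2\<close> by blast
    have "partition_entropy M (itinerary T (\<lambda>x. x \<in> U) n)
      \<le> partition_entropy M (itinerary T (\<lambda>x. x \<in> B m) n)
        + partition_entropy M (itinerary T (\<lambda>x. x \<in> U - B m) n)"
      using BU[of m]
      by (intro partition_entropy_itinerary_le_add[OF T, where f = "(\<or>)"] simple_function_mem U B UB) auto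
    also have "\<dots> \<le> \<epsilon> / 2 * real n + real n * (\<epsilon> / 2)"
      using partition_entropy_itinerary_le[OF T simple_function_mem[OF UB], of n] n(2)
        mult_left_mono[OF D, of "real n"] by linarith
    finally show "\<exists>n>0. partition_entropy M (itinerary T (\<lambda>x. x \<in> U) n) \<le> \<epsilon> * real n"
      using n(1) by (intro exI[of _ n]) (auto simp: field_simps)
  qed
  then show ?thesis using U by (simp add: pinsker_def U_def)
qed

lemma sigma_algebra_pinsker:
  assumes "mp_automorphism M T"
  shows "sigma_algebra (space M) (pinsker M T)"
  unfolding sigma_algebra_iff2
proof (intro conjI ballI allI impI)
  show "pinsker M T \<subseteq> Pow (space M)" using sets.sets_into_space by (auto simp: pinsker_def)
  show "{} \<in> pinsker M T" using zero_entropy_null_set[OF assms, of "{}"] by (simp add: pinsker_def)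
next
  fix A assume "A \<in> pinsker M T"
  then have A: "A \<in> sets M" "space M - A \<in> sets M" "zero_entropy M T (\<lambda>x. x \<in> A)"
    by (auto simp: pinsker_def)
  have "zero_entropy M T (\<lambda>x. x \<in> space M - A)"
    by (rule zero_entropy_compose[OF assms simple_function_mem[OF A(1)] simple_function_mem[OF A(2)] A(3),
          where f = Not]) auto
  then show "space M - A \<in> pinsker M T" using A by (simp add: pinsker_def)
next
  fix A :: "nat \<Rightarrow> 'a set" assume "range A \<subseteq> pinsker M T"
  then show "(\<Union>i. A i) \<in> pinsker M T" by (intro pinsker_countable_UN assms) auto
qed

text \<open>The finitely many atoms are joined one after the other; the resulting list of membership
  bits determines \<open>q\<close>.\<close>

lemma zero_entropy_pinsker_measurable:
  assumes T: "mp_automorphism M T" and q: "simple_function M q"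
    and sets: "\<And>a. q -` {a} \<inter> space M \<in> pinsker M T"
  shows "zero_entropy M T q"
proof -
  let ?A = "\<lambda>a. q -` {a} \<inter> space M"
  have A: "?A a \<in> sets M" "zero_entropy M T (\<lambda>x. x \<in> ?A a)" for a
    using sets[of a] by (auto simp: pinsker_def)
  note simple = simple_function_mem[OF A(1)]
  have zero: "zero_entropy M T (\<lambda>x. map (\<lambda>a. x \<in> ?A a) as)" for as
  proof (induction as)
    case Nil
    \<comment> \<open>A constant is a function of membership in \<open>{}\<close>, which is a null
      set.\<close>
    show ?case
      by (rule zero_entropy_compose[where p = "\<lambda>x. x \<in> {}" and f = "\<lambda>_. []"])
        (use T zero_entropy_null_set[OF T, of "{}"] in auto)
  next
    case (Cons a as)
    show ?case
      by (rule zero_entropy_determined[OF T simple[of a] _ _ A(2)[of a] Cons, where f = "(#)"])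
        (use simple_function_map[of "a # as", OF simple] simple_function_map[of as, OF simple] in auto)
  qed
  obtain as where as: "set as = q ` space M"
    using q finite_list[of "q ` space M"] by (auto simp: simple_function_def)
  let ?Y = "\<lambda>x. map (\<lambda>a. x \<in> ?A a) as"
  \<comment> \<open>The decoding function: any point with the same bits has the same value of
    \<open>q\<close>, because the bit of the atom of \<open>x\<close> is among them.\<close>
  have "q x = q (SOME y. y \<in> space M \<and> ?Y y = ?Y x)" if x: "x \<in> space M" for x
  proof -
    define y where "y = (SOME y. y \<in> space M \<and> ?Y y = ?Y x)"
    have y: "y \<in> space M \<and> ?Y y = ?Y x"
      unfolding y_def by (rule someI[of _ x]) (use x in auto)
    moreover have "q x \<in> set as" using as x by auto
    ultimately have "(y \<in> ?A (q x)) = (x \<in> ?A (q x))"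
      unfolding map_eq_conv by blast
    then show ?thesis using x by (simp add: y_def)
  qed
  then show ?thesis
    by (rule zero_entropy_compose[OF T simple_function_map[OF simple] q zero[of as]])
qed

text \<open>Zero entropy is established on \<open>M\<close>, while the Kolmogorov property concerns
  the automorphism of the coarser space; this allows passage between the two.\<close>

lemma partition_entropy_restr_to_subalg:
  assumes "subalgebra M F" "prob_space M" "simple_function (restr_to_subalg M F) p"
  shows "simple_function M p" "partition_entropy (restr_to_subalg M F) p = partition_entropy M p"
proof -
  have level: "p -` {v} \<inter> space M \<in> sets F" for v
    using simple_functionD(2)[OF assms(3), of "{v}"] assms(1)
    by (simp add: space_restr_to_subalg sets_restr_to_subalg)
  then show simple: "simple_function M p"
    using assms(1,3) by (auto simp: simple_function_def space_restr_to_subalg subalgebra_def)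
  show "partition_entropy (restr_to_subalg M F) p = partition_entropy M p"
  proof (intro partition_entropy_cong_distribution prob_space_restr_to_subalg assms simple)
    show "measure (restr_to_subalg M F) (p -` {v} \<inter> space (restr_to_subalg M F))
      = measure M (p -` {v} \<inter> space M)" for v
      using emeasure_restr_to_subalg[OF assms(1) level] by (simp add: measure_def space_restr_to_subalg)
  qed
qed

text \<open>The Kolmogorov property speaks of factors, so the Pinsker sets must form one: a
  sigma-algebra invariant in both directions, all of whose finite partitions have zero
  entropy.\<close>

lemma kolmogorov_pinsker_trivial:
  assumes T: "mp_automorphism M T" and K: "kolmogorov M T" and A: "A \<in> pinsker M T"
  shows "measure M A = 0 \<or> measure M A = 1"
proof -
  interpret M: prob_space M using T by (rule mp_automorphism_prob_space)
  interpret P: sigma_algebra "space M" "pinsker M T" using T by (rule sigma_algebra_pinsker)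
  define F where "F = sigma (space M) (pinsker M T)"
  have F: "space F = space M" "sets F = pinsker M T" by (auto simp: F_def)
  have sub: "subalgebra M F" by (auto simp: subalgebra_def F pinsker_def)
  define R where "R = restr_to_subalg M F"
  have R: "space R = space M" "sets R = pinsker M T"
    using sub by (auto simp: R_def space_restr_to_subalg sets_restr_to_subalg F)
  have bij: "bij_betw T (space M) (space M)" using T by (simp add: mp_automorphism_def)
  have pre: "T -` A \<inter> space M \<in> pinsker M T" if A: "A \<in> pinsker M T" for A
  proof -
    have A': "A \<in> sets M" "zero_entropy M T (\<lambda>x. x \<in> A)" using A by (auto simp: pinsker_def)
    have pre: "T -` A \<inter> space M \<in> sets M"
      using mp_automorphism_measurable[OF T] A'(1) by (rule measurable_sets)
    have "zero_entropy M T (\<lambda>x. T x \<in> A)"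
      using zero_entropy_shift[OF T simple_function_mem[OF A'(1)]] A'(2) by simp
    then have "zero_entropy M T (\<lambda>x. x \<in> T -` A \<inter> space M)"
      by (rule zero_entropy_compose[OF T _ simple_function_mem[OF pre], rotated, where f = "\<lambda>b. b"])
        (use simple_function_funpow[OF T simple_function_mem[OF A'(1)], of 1] in auto)
    then show ?thesis using pre by (simp add: pinsker_def)
  qed
  have inv_pre: "inv_into (space M) T -` A \<inter> space M \<in> pinsker M T" if A: "A \<in> pinsker M T" for A
  proof -
    \<comment> \<open>\<open>B\<close> is the image of \<open>A\<close> under \<open>T\<close>, so
      \<open>T x \<in> B\<close> is the same condition on points of the space as
      \<open>x \<in> A\<close>, and the shift lemma removes the \<open>T\<close>.\<close>
    define B where "B = inv_into (space M) T -` A \<inter> space M"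
    have A': "A \<in> sets M" "zero_entropy M T (\<lambda>x. x \<in> A)" using A by (auto simp: pinsker_def)
    have "inv_into (space M) T \<in> M \<rightarrow>\<^sub>M M" using T by (simp add: mp_automorphism_def)
    then have B: "B \<in> sets M" unfolding B_def using A'(1) by (rule measurable_sets)
    have "zero_entropy M T (\<lambda>x. T x \<in> B)"
      by (rule zero_entropy_compose[OF T simple_function_mem[OF A'(1)] _ A'(2), where f = "\<lambda>b. b"])
        (use simple_function_funpow[OF T simple_function_mem[OF B], of 1] bij in
          \<open>auto simp: B_def bij_betw_def\<close>)
    then have "zero_entropy M T (\<lambda>x. x \<in> B)"
      using zero_entropy_shift[OF T simple_function_mem[OF B]] by simp
    then show ?thesis using B by (simp add: pinsker_def B_def)
  qed
  have T_meas: "T \<in> R \<rightarrow>\<^sub>M R"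
    using pre measurable_space[OF mp_automorphism_measurable[OF T]] by (auto simp: measurable_def R)
  have inv_meas: "inv_into (space M) T \<in> R \<rightarrow>\<^sub>M R"
    using inv_pre bij by (auto simp: measurable_def R bij_betw_def inv_into_into)
  have "distr R R T = R"
  proof (rule measure_eqI)
    fix B assume "B \<in> sets (distr R R T)"
    then have B: "B \<in> pinsker M T" by (simp add: R)
    then have "emeasure (distr R R T) B = emeasure M (T -` B \<inter> space M)"
      using T_meas pre[OF B] emeasure_restr_to_subalg[OF sub]
      by (subst emeasure_distr) (auto simp: R F R_def[symmetric])
    also have "\<dots> = emeasure (distr M M T) B"
      using B mp_automorphism_measurable[OF T] by (subst emeasure_distr) (auto simp: pinsker_def)
    also have "\<dots> = emeasure R B"
      using T B emeasure_restr_to_subalg[OF sub, of B] by (simp add: mp_automorphism_def R_def F)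
    finally show "emeasure (distr R R T) B = emeasure R B" .
  qed simp
  then have auto: "mp_automorphism R T"
    using T_meas inv_meas bij prob_space_restr_to_subalg[OF sub M.prob_space_axioms]
    by (simp add: mp_automorphism_def R R_def[symmetric])
  have zero: "entropy_of_partition R T q = 0" if q: "simple_function R q" for q :: "'a \<Rightarrow> nat"
  proof -
    note restr = partition_entropy_restr_to_subalg[OF sub M.prob_space_axioms, folded R_def]
    have "zero_entropy M T q"
      using simple_functionD(2)[OF q]
      by (intro zero_entropy_pinsker_measurable[OF T restr(1)[OF q]]) (simp add: R)
    then have "zero_entropy R T q"
      using restr(2)[OF simple_function_itinerary[OF auto q]] by (simp add: zero_entropy_def)
    then show ?thesis using zero_entropy_iff[OF auto q] by simp
  qed
  have "ks_entropy R T = (SUP p\<in>{p :: 'a \<Rightarrow> nat. simple_function R p}. 0)"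
    unfolding ks_entropy_def by (intro SUP_cong) (auto simp: zero zero_ereal_def)
  \<comment> \<open>The constant partition shows that the supremum runs over a nonempty set; an
    empty one would give minus infinity.\<close>
  also have "\<dots> = 0" by (rule cSUP_const) (auto intro: exI[of _ "\<lambda>_. 0"])
  finally have "trivial_factor M F"
    using K auto sub by (auto simp: kolmogorov_def factor_algebra_def R_def)
  then show ?thesis using A by (simp add: trivial_factor_def F)
qed

section \<open>Conditionally independent copies\<close>

abbreviation words :: "'l set \<Rightarrow> nat \<Rightarrow> 'l list set" where
  "words B m \<equiv> {bs. set bs \<subseteq> B \<and> length bs = m}"

lemma sum_words_Suc:
  assumes "finite B"
  shows "(\<Sum>bs\<in>words B (Suc m). f bs) = (\<Sum>b\<in>B. \<Sum>bs\<in>words B m. f (b # bs))"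
proof -
  have "words B (Suc m) = (\<lambda>(b, bs). b # bs) ` (B \<times> words B m)"
    by (auto simp: image_iff length_Suc_conv)
  moreover have "inj_on (\<lambda>(b, bs). b # bs) (B \<times> words B m)" by (auto simp: inj_on_def)
  ultimately show ?thesis
    by (simp add: sum.reindex sum.cartesian_product case_prod_unfold)
qed

text \<open>For a probability vector \<open>\<phi>\<close>, the products along words are the law of
  independent draws. Finite sums keep this and the next two lemmas applicable at each point
  \<open>x\<close> separately, with the conditional probabilities given \<open>x\<close> as
  \<open>\<phi>\<close>.\<close>

lemma sum_words_weight:
  fixes \<phi> :: "'l \<Rightarrow> real"
  assumes "finite B" "(\<Sum>b\<in>B. \<phi> b) = 1"
  shows "(\<Sum>bs\<in>words B m. \<Prod>b\<leftarrow>bs. \<phi> b) = 1"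
proof (induction m)
  case 0
  have "words B 0 = {[]}" by auto
  then show ?case by simp
next
  case (Suc m)
  then show ?case
    using assms by (simp add: sum_words_Suc sum_distrib_left[symmetric] del: length_Suc_conv)
qed

lemma sum_words_nth:
  fixes \<phi> F :: "'l \<Rightarrow> real"
  assumes "finite B" "(\<Sum>b\<in>B. \<phi> b) = 1" "j < m"
  shows "(\<Sum>bs\<in>words B m. (\<Prod>b\<leftarrow>bs. \<phi> b) * F (bs ! j)) = (\<Sum>b\<in>B. \<phi> b * F b)"
  using assms(3)
proof (induction m arbitrary: j)
  case (Suc m)
  show ?case
  proof (cases j)
    case 0
    have "(\<Sum>bs\<in>words B (Suc m). (\<Prod>b\<leftarrow>bs. \<phi> b) * F (bs ! j))
      = (\<Sum>b\<in>B. \<phi> b * F b * (\<Sum>bs\<in>words B m. \<Prod>b\<leftarrow>bs. \<phi> b))"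
      using assms(1) 0 by (simp add: sum_words_Suc sum_distrib_left mult_ac)
    then show ?thesis using assms by (simp add: sum_words_weight)
  next
    case (Suc k)
    have "(\<Sum>bs\<in>words B (Suc m). (\<Prod>b\<leftarrow>bs. \<phi> b) * F (bs ! j))
      = (\<Sum>b\<in>B. \<phi> b * (\<Sum>bs\<in>words B m. (\<Prod>b\<leftarrow>bs. \<phi> b) * F (bs ! k)))"
      using assms(1) Suc by (simp add: sum_words_Suc sum_distrib_left mult_ac)
    then show ?thesis
      using Suc.IH[of k] Suc.prems Suc assms by (simp add: sum_distrib_right[symmetric])
  qed
qed simp

text \<open>Independent centred variables are uncorrelated, so variances add: when the first letter
  is split off, the cross term carries the factor \<open>\<Sum>b\<in>B. \<phi> b * Y b\<close>,
  which is 0.\<close>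

lemma sum_words_variance:
  fixes \<phi> Y :: "'l \<Rightarrow> real"
  assumes "finite B" "(\<Sum>b\<in>B. \<phi> b) = 1" "(\<Sum>b\<in>B. \<phi> b * Y b) = 0"
  shows "(\<Sum>bs\<in>words B m. (\<Prod>b\<leftarrow>bs. \<phi> b) * (\<Sum>b\<leftarrow>bs. Y b)\<^sup>2)
    = real m * (\<Sum>b\<in>B. \<phi> b * (Y b)\<^sup>2)"
proof (induction m)
  case 0
  have "words B 0 = {[]}" by auto
  then show ?case by simp
next
  case (Suc m)
  let ?V = "\<Sum>b\<in>B. \<phi> b * (Y b)\<^sup>2"
  let ?W = "\<lambda>bs. \<Prod>b\<leftarrow>bs. \<phi> b" and ?S = "\<lambda>bs. \<Sum>b\<leftarrow>bs. Y b"
  have "(\<Sum>bs\<in>words B m. ?W (b # bs) * (?S (b # bs))\<^sup>2)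
    = \<phi> b * (Y b)\<^sup>2 + (\<phi> b * Y b) * (2 * (\<Sum>bs\<in>words B m. ?W bs * ?S bs))
      + \<phi> b * (real m * ?V)" for b
  proof -
    have "(\<Sum>bs\<in>words B m. ?W (b # bs) * (?S (b # bs))\<^sup>2)
      = (\<Sum>bs\<in>words B m. \<phi> b * (Y b)\<^sup>2 * ?W bs + (\<phi> b * Y b) * (2 * (?W bs * ?S bs))
          + \<phi> b * (?W bs * (?S bs)\<^sup>2))"
      by (intro sum.cong) (auto simp: power2_eq_square algebra_simps)
    then show ?thesis
      by (simp add: sum.distrib sum_distrib_left[symmetric] sum_words_weight assms Suc)
  qed
  then have "(\<Sum>bs\<in>words B (Suc m). ?W bs * (?S bs)\<^sup>2)
    = (\<Sum>b\<in>B. \<phi> b * (Y b)\<^sup>2 + (\<phi> b * Y b) * (2 * (\<Sum>bs\<in>words B m. ?W bs * ?S bs))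
      + \<phi> b * (real m * ?V))"
    using assms(1) by (simp only: sum_words_Suc)
  also have "\<dots> = ?V + real m * ?V"
    using assms(2,3) by (simp add: sum.distrib sum_distrib_right[symmetric])
  finally show ?case by (simp add: algebra_simps)
qed

text \<open>
  The joint law of a point \<open>x\<close> and of \<open>m\<close> labels that are independent given \<open>x\<close>, each equal to \<open>b\<close>
  with conditional probability \<open>\<psi> b x\<close>.
\<close>

definition copies :: "'a measure \<Rightarrow> 'l set \<Rightarrow> ('l \<Rightarrow> 'a \<Rightarrow> real) \<Rightarrow> nat \<Rightarrow> ('a \<times> 'l list) measure" where
  "copies M B \<psi> m =
     density (M \<Otimes>\<^sub>M count_space (words B m)) (\<lambda>(x, bs). ennreal (\<Prod>b\<leftarrow>bs. \<psi> b x))"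

text \<open>The weights will be versions of conditional probabilities, so their signs and their sum
  are controlled only up to null sets.\<close>

locale conditional_copies = prob_space M for M :: "'a measure" +
  fixes B :: "'l set" and \<psi> :: "'l \<Rightarrow> 'a \<Rightarrow> real" and m :: nat
  assumes finite_labels: "finite B"
    and measurable_weight: "\<And>b. b \<in> B \<Longrightarrow> \<psi> b \<in> borel_measurable M"
    and weight_nonneg: "\<And>b. b \<in> B \<Longrightarrow> AE x in M. 0 \<le> \<psi> b x"
    and weight_sum: "AE x in M. (\<Sum>b\<in>B. \<psi> b x) = 1"
begin

abbreviation "C \<equiv> copies M B \<psi> m"

lemma finite_words: "finite (words B m)"
  using finite_labels by (rule finite_lists_length_eq)

lemma space_copies: "space C = space M \<times> words B m"
  by (simp add: copies_def space_pair_measure)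

lemma sets_copies: "sets C = sets (M \<Otimes>\<^sub>M count_space (words B m))"
  by (simp add: copies_def)

lemma measurable_copies: "measurable C = measurable (M \<Otimes>\<^sub>M count_space (words B m))"
  by (intro ext measurable_cong_sets sets_copies refl)

lemma measurable_prod_weight: "set bs \<subseteq> B \<Longrightarrow> (\<lambda>x. \<Prod>b\<leftarrow>bs. \<psi> b x) \<in> borel_measurable M"
  by (induction bs) (auto intro: borel_measurable_times measurable_weight)

text \<open>The second coordinate takes finitely many values, so measurability can be checked on
  each slice.\<close>

lemma measurable_copiesI:
  assumes "\<And>bs. bs \<in> words B m \<Longrightarrow> (\<lambda>x. f (x, bs)) \<in> M \<rightarrow>\<^sub>M R"
  shows "f \<in> C \<rightarrow>\<^sub>M R"
proof -
  have "(\<lambda>z. f (fst z, snd z)) \<in> M \<Otimes>\<^sub>M count_space (words B m) \<rightarrow>\<^sub>M R"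
    by (rule measurable_compose_countable'[where f = "\<lambda>bs z. f (fst z, bs)" and g = snd and I = "words B m"])
      (use finite_words assms in \<open>auto intro: measurable_compose[OF measurable_fst] countable_finite\<close>)
  then show ?thesis by (simp add: measurable_copies)
qed

text \<open>In the density of \<open>copies\<close>, \<open>ennreal\<close> truncates negative
  numbers to 0; by this lemma the truncation acts only over a null set of points.\<close>

lemma prod_weight_nonneg: "AE x in M. \<forall>bs\<in>words B m. 0 \<le> (\<Prod>b\<leftarrow>bs. \<psi> b x)"
proof -
  have "AE x in M. \<forall>b\<in>B. 0 \<le> \<psi> b x"
    using finite_labels weight_nonneg by (simp add: AE_finite_all)
  then show ?thesis
  proof eventually_elim
    case (elim x)
    then have "set bs \<subseteq> B \<Longrightarrow> 0 \<le> (\<Prod>b\<leftarrow>bs. \<psi> b x)" for bs by (induction bs) auto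
    then show ?case by auto
  qed
qed

text \<open>Reduces integrals over the copies to finite sums at a fixed \<open>x\<close>, where the
  lemmas on words apply.\<close>

lemma nn_integral_copies:
  assumes f: "f \<in> borel_measurable C" and nonneg: "\<And>z. 0 \<le> f z"
  shows "(\<integral>\<^sup>+z. ennreal (f z) \<partial>C)
    = (\<integral>\<^sup>+x. ennreal (\<Sum>bs\<in>words B m. (\<Prod>b\<leftarrow>bs. \<psi> b x) * f (x, bs)) \<partial>M)"
proof -
  interpret W: sigma_finite_measure "count_space (words B m)"
    using finite_words by (rule sigma_finite_measure_count_space_finite)
  have dens: "(\<lambda>z. ennreal (\<Prod>b\<leftarrow>snd z. \<psi> b (fst z))) \<in> borel_measurable C"
    by (rule measurable_copiesI) (auto intro: measurable_compose[OF measurable_prod_weight measurable_ennreal])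
  have f': "(\<lambda>z. ennreal (f z)) \<in> borel_measurable (M \<Otimes>\<^sub>M count_space (words B m))"
    using f unfolding measurable_copies by measurable
  have "(\<integral>\<^sup>+z. ennreal (f z) \<partial>C) = (\<integral>\<^sup>+z. ennreal (\<Prod>b\<leftarrow>snd z. \<psi> b (fst z)) * ennreal (f z)
      \<partial>(M \<Otimes>\<^sub>M count_space (words B m)))"
    unfolding copies_def case_prod_unfold using dens f' unfolding measurable_copies
    by (subst nn_integral_density) auto
  also have "\<dots> = (\<integral>\<^sup>+x. (\<integral>\<^sup>+bs. ennreal (\<Prod>b\<leftarrow>bs. \<psi> b x) * ennreal (f (x, bs))
      \<partial>count_space (words B m)) \<partial>M)"
    using dens f' unfolding measurable_copies
    by (subst W.nn_integral_fst[symmetric]) auto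
  also have "\<dots> = (\<integral>\<^sup>+x. ennreal (\<Sum>bs\<in>words B m. (\<Prod>b\<leftarrow>bs. \<psi> b x) * f (x, bs)) \<partial>M)"
  proof (rule nn_integral_cong_AE)
    show "AE x in M. (\<integral>\<^sup>+bs. ennreal (\<Prod>b\<leftarrow>bs. \<psi> b x) * ennreal (f (x, bs)) \<partial>count_space (words B m))
      = ennreal (\<Sum>bs\<in>words B m. (\<Prod>b\<leftarrow>bs. \<psi> b x) * f (x, bs))"
      using prod_weight_nonneg
    proof eventually_elim
      case (elim x)
      then have "(\<Sum>bs\<in>words B m. ennreal (\<Prod>b\<leftarrow>bs. \<psi> b x) * ennreal (f (x, bs)))
        = (\<Sum>bs\<in>words B m. ennreal ((\<Prod>b\<leftarrow>bs. \<psi> b x) * f (x, bs)))"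
        by (intro sum.cong refl) (auto simp: ennreal_mult nonneg)
      also have "\<dots> = ennreal (\<Sum>bs\<in>words B m. (\<Prod>b\<leftarrow>bs. \<psi> b x) * f (x, bs))"
        using elim nonneg by (intro sum_ennreal) auto
      finally show ?case using finite_words by (simp add: nn_integral_count_space_finite)
    qed
  qed
  finally show ?thesis .
qed

text \<open>For almost every \<open>x\<close> the word weights sum to 1, so the first marginal is
  \<open>M\<close>. Partitions of \<open>M\<close> thus keep their entropy when lifted to the
  copies.\<close>

lemma emeasure_copies_fst:
  assumes "A \<in> sets M"
  shows "emeasure C (A \<times> words B m) = emeasure M A"
proof -
  have A: "A \<times> words B m \<in> sets C" using assms by (simp add: sets_copies)
  have "emeasure C (A \<times> words B m) = (\<integral>\<^sup>+z. ennreal (indicator (A \<times> words B m) z) \<partial>C)"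
    using A by (simp add: ennreal_indicator)
  also have "\<dots> = (\<integral>\<^sup>+x. ennreal (\<Sum>bs\<in>words B m. (\<Prod>b\<leftarrow>bs. \<psi> b x) * indicator (A \<times> words B m) (x, bs)) \<partial>M)"
    using A by (intro nn_integral_copies) auto
  also have "\<dots> = (\<integral>\<^sup>+x. indicator A x \<partial>M)"
  proof (intro nn_integral_cong_AE, use weight_sum in eventually_elim)
    case (elim x)
    have "(\<Sum>bs\<in>words B m. (\<Prod>b\<leftarrow>bs. \<psi> b x) * indicator (A \<times> words B m) (x, bs))
      = (\<Sum>bs\<in>words B m. (\<Prod>b\<leftarrow>bs. \<psi> b x) * indicator A x)"
      by (intro sum.cong) (auto simp: indicator_def)
    then show ?case
      using elim finite_labels by (simp add: sum_distrib_right[symmetric] sum_words_weight ennreal_indicator)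
  qed
  finally show ?thesis using assms by simp
qed

lemma prob_space_copies: "prob_space C"
  using emeasure_copies_fst[of "space M"] by (intro prob_spaceI) (simp add: space_copies emeasure_space_1)

lemma simple_function_copies_fst:
  assumes "simple_function M f"
  shows "simple_function C (\<lambda>z. f (fst z))"
proof -
  have "fst \<in> C \<rightarrow>\<^sub>M M" unfolding measurable_copies by simp
  then show ?thesis using simple_function_comp[OF _ assms, of fst C] by (simp add: comp_def)
qed

lemma simple_function_copies_snd: "simple_function C (\<lambda>z. f (snd z))"
proof -
  have "snd \<in> C \<rightarrow>\<^sub>M count_space (words B m)" unfolding measurable_copies by simp
  moreover have "simple_function (count_space (words B m)) f"
    using finite_words by (auto simp: simple_function_def)
  ultimately show ?thesis using simple_function_comp[of snd C _ f] by (simp add: comp_def)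
qed

lemma partition_entropy_copies_fst:
  assumes "simple_function M f"
  shows "partition_entropy C (\<lambda>z. f (fst z)) = partition_entropy M f"
proof (intro partition_entropy_cong_distribution prob_space_copies prob_space_axioms
    simple_function_copies_fst assms)
  fix v
  have "(\<lambda>z. f (fst z)) -` {v} \<inter> space C = (f -` {v} \<inter> space M) \<times> words B m"
    by (auto simp: space_copies)
  then show "measure C ((\<lambda>z. f (fst z)) -` {v} \<inter> space C) = prob (f -` {v} \<inter> space M)"
    using emeasure_copies_fst[OF simple_functionD(2)[OF assms]] by (simp add: measure_def)
qed

text \<open>Summing out the other letters leaves \<open>\<psi> b x\<close>. In the application this
  gives each letter the law of the itinerary.\<close>

lemma measure_copies_nth:
  assumes "j < m" "b \<in> B" "integrable M (\<psi> b)"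
  shows "measure C {z \<in> space C. snd z ! j = b} = (\<integral>x. \<psi> b x \<partial>M)"
proof -
  let ?E = "{z \<in> space C. snd z ! j = b}"
  have E: "?E \<in> sets C"
    using simple_functionD(2)[OF simple_function_copies_snd[of "\<lambda>bs. bs ! j"], of "{b}"]
    by (simp add: vimage_def Int_def conj_commute)
  have "emeasure C ?E = (\<integral>\<^sup>+z. ennreal (indicator ?E z) \<partial>C)"
    using E by (simp add: ennreal_indicator)
  also have "\<dots> = (\<integral>\<^sup>+x. ennreal (\<Sum>bs\<in>words B m. (\<Prod>b\<leftarrow>bs. \<psi> b x) * indicator ?E (x, bs)) \<partial>M)"
    using E by (intro nn_integral_copies) auto
  also have "\<dots> = (\<integral>\<^sup>+x. ennreal (\<psi> b x) \<partial>M)"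
  proof (rule nn_integral_cong_AE)
    show "AE x in M. ennreal (\<Sum>bs\<in>words B m. (\<Prod>b\<leftarrow>bs. \<psi> b x) * indicator ?E (x, bs)) = ennreal (\<psi> b x)"
      using weight_sum AE_space
    proof eventually_elim
      case (elim x)
      have "(\<Sum>bs\<in>words B m. (\<Prod>b\<leftarrow>bs. \<psi> b x) * indicator ?E (x, bs))
        = (\<Sum>bs\<in>words B m. (\<Prod>b\<leftarrow>bs. \<psi> b x) * of_bool (bs ! j = b))"
        using elim by (intro sum.cong) (auto simp: space_copies)
      also have "\<dots> = (\<Sum>b'\<in>B. \<psi> b' x * of_bool (b' = b))"
        by (rule sum_words_nth[OF finite_labels elim(1) assms(1), where F = "\<lambda>b'. of_bool (b' = b)"])
      finally show ?case using assms(2) finite_labels by simp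
    qed
  qed
  also have "\<dots> = ennreal (\<integral>x. \<psi> b x \<partial>M)"
    using assms weight_nonneg by (intro nn_integral_eq_integral)
  finally show ?thesis
    using assms weight_nonneg by (simp add: measure_def integral_nonneg_AE)
qed

text \<open>Chebyshev's inequality given \<open>x\<close>, for the average of \<open>m\<close>
  independent labels with mean \<open>t x\<close>. The bound depends neither on \<open>x\<close> nor
  on \<open>F\<close>, so one \<open>m\<close> will serve all times.\<close>

lemma weak_law_copies:
  assumes F: "\<And>b. b \<in> B \<Longrightarrow> \<bar>F b\<bar> \<le> 1" and t: "t \<in> borel_measurable M"
    and mean: "AE x in M. (\<Sum>b\<in>B. \<psi> b x * F b) = t x" and d: "0 < d" and m: "0 < m"
  shows "measure C {z \<in> space C. d < \<bar>(\<Sum>b\<leftarrow>snd z. F b) / real m - t (fst z)\<bar>} \<le> 4 / (real m * d\<^sup>2)"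
proof -
  define X where "X z = (\<Sum>b\<leftarrow>snd z. F b) / real m - t (fst z)" for z
  have X: "X \<in> borel_measurable C"
    unfolding X_def by (rule measurable_copiesI) (use t in simp)
  have "{z \<in> space C. d < \<bar>X z\<bar>} \<in> sets C" using X by measurable
  then have "emeasure C {z \<in> space C. d < \<bar>X z\<bar>} = (\<integral>\<^sup>+z. indicator {z \<in> space C. d < \<bar>X z\<bar>} z \<partial>C)"
    by simp
  also have "\<dots> \<le> (\<integral>\<^sup>+z. ennreal ((X z)\<^sup>2 / d\<^sup>2) \<partial>C)"
  proof (intro nn_integral_mono)
    fix z
    have "d\<^sup>2 \<le> (X z)\<^sup>2" if "d < \<bar>X z\<bar>" using that d power_mono[of d "\<bar>X z\<bar>" 2] by simp
    then have "1 \<le> (X z)\<^sup>2 / d\<^sup>2" if "d < \<bar>X z\<bar>" using that d by simp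
    then show "indicator {z \<in> space C. d < \<bar>X z\<bar>} z \<le> ennreal ((X z)\<^sup>2 / d\<^sup>2)"
      by (auto simp: indicator_def)
  qed
  also have "\<dots> = (\<integral>\<^sup>+x. ennreal (\<Sum>bs\<in>words B m. (\<Prod>b\<leftarrow>bs. \<psi> b x) * ((X (x, bs))\<^sup>2 / d\<^sup>2)) \<partial>M)"
    using X by (intro nn_integral_copies) auto
  also have "\<dots> \<le> (\<integral>\<^sup>+x. ennreal (4 / (real m * d\<^sup>2)) \<partial>M)"
  proof (rule nn_integral_mono_AE)
    have "AE x in M. \<forall>b\<in>B. 0 \<le> \<psi> b x"
      using finite_labels weight_nonneg by (simp add: AE_finite_all)
    then show "AE x in M. ennreal (\<Sum>bs\<in>words B m. (\<Prod>b\<leftarrow>bs. \<psi> b x) * ((X (x, bs))\<^sup>2 / d\<^sup>2))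
      \<le> ennreal (4 / (real m * d\<^sup>2))"
      using weight_sum mean
    proof eventually_elim
      case (elim x)
      \<comment> \<open>The centred labels. \<open>F b\<close> and its mean \<open>t x\<close> both
        lie between -1 and 1, so the square is at most 4; this is the 4 of the statement.\<close>
      define Y where "Y b = F b - t x" for b
      have "\<bar>t x\<bar> \<le> (\<Sum>b\<in>B. \<bar>\<psi> b x * F b\<bar>)" unfolding elim(3)[symmetric] by (rule sum_abs)
      also have "\<dots> \<le> (\<Sum>b\<in>B. \<psi> b x)"
        using elim(1) F by (intro sum_mono) (auto simp: abs_mult intro: mult_left_le)
      finally have "\<bar>t x\<bar> \<le> 1" using elim by simp
      then have "\<bar>Y b\<bar> \<le> 2" if "b \<in> B" for b using F[OF that] by (auto simp: Y_def)
      then have Y: "(Y b)\<^sup>2 \<le> 4" if "b \<in> B" for b using that abs_le_square_iff[of "Y b" 2] by simp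
      have S: "X (x, bs) = (\<Sum>b\<leftarrow>bs. Y b) / real m" if "bs \<in> words B m" for bs
        using that m by (auto simp: X_def Y_def sum_list_subtractf sum_list_triv field_simps)
      have "(\<Sum>bs\<in>words B m. (\<Prod>b\<leftarrow>bs. \<psi> b x) * ((X (x, bs))\<^sup>2 / d\<^sup>2))
        = (\<Sum>bs\<in>words B m. (\<Prod>b\<leftarrow>bs. \<psi> b x) * (\<Sum>b\<leftarrow>bs. Y b)\<^sup>2 / (real m * d)\<^sup>2)"
        by (intro sum.cong refl) (simp add: S power_divide power_mult_distrib)
      also have "\<dots> = real m * (\<Sum>b\<in>B. \<psi> b x * (Y b)\<^sup>2) / (real m * d)\<^sup>2"
        using elim by (subst sum_words_variance[symmetric, OF finite_labels])
          (auto simp: Y_def algebra_simps sum_subtractf sum_distrib_left[symmetric] sum_divide_distrib)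
      also have "\<dots> \<le> real m * (\<Sum>b\<in>B. \<psi> b x * 4) / (real m * d)\<^sup>2"
        using elim(1) Y by (intro divide_right_mono mult_left_mono sum_mono) auto
      also have "\<dots> = 4 / (real m * d\<^sup>2)"
        using elim(2) m by (simp add: sum_distrib_right[symmetric] power2_eq_square)
      finally show ?case by (rule ennreal_leI)
    qed
  qed
  also have "\<dots> = ennreal (4 / (real m * d\<^sup>2))" by (simp add: emeasure_space_1)
  finally show ?thesis
    unfolding X_def by (simp add: measure_def enn2real_leI)
qed

end

section \<open>Densities of joinings with zero entropy\<close>

text \<open>
  \<open>J Q x\<close> stands for the conditional probability of \<open>Q\<close> given \<open>x\<close> in a joining of \<open>T\<close> and \<open>S\<close>. Additivity
  and equivariance are only required almost everywhere, with an exceptional set depending on the sets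
  involved, so that no disintegration of the joining is needed.
\<close>

locale joining_density =
  fixes M :: "'a measure" and T and N :: "'b measure" and S and J :: "'b set \<Rightarrow> 'a \<Rightarrow> real"
  assumes T: "mp_automorphism M T" and S: "mp_automorphism N S"
    and J_integrable: "\<And>Q. Q \<in> sets N \<Longrightarrow> integrable M (J Q)"
    and J_integral: "\<And>Q. Q \<in> sets N \<Longrightarrow> (\<integral>x. J Q x \<partial>M) = measure N Q"
    and J_nonneg: "\<And>Q. Q \<in> sets N \<Longrightarrow> AE x in M. 0 \<le> J Q x"
    and J_space: "AE x in M. J (space N) x = 1"
    and J_Un: "\<And>A B. A \<in> sets N \<Longrightarrow> B \<in> sets N \<Longrightarrow> A \<inter> B = {} \<Longrightarrow>
      AE x in M. J (A \<union> B) x = J A x + J B x"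
    and J_equivariant: "\<And>Q. Q \<in> sets N \<Longrightarrow> AE x in M. J (S -` Q \<inter> space N) x = J Q (T x)"
begin

lemma J_finite_UN:
  assumes "finite I" "\<And>i. i \<in> I \<Longrightarrow> A i \<in> sets N" "disjoint_family_on A I"
  shows "AE x in M. J (\<Union>i\<in>I. A i) x = (\<Sum>i\<in>I. J (A i) x)"
  using assms
proof (induction I)
  case empty
  \<comment> \<open>Additivity for the empty set and itself reads
    \<open>J {} x = J {} x + J {} x\<close>, which forces the value 0.\<close>
  show ?case using J_Un[of "{}" "{}"] by simp
next
  case (insert i I)
  have "A i \<inter> (\<Union>i\<in>I. A i) = {}" using insert by (auto simp: disjoint_family_on_def)
  then have "AE x in M. J (A i \<union> (\<Union>i\<in>I. A i)) x = J (A i) x + J (\<Union>i\<in>I. A i) x"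
    using insert by (intro J_Un) auto
  moreover have "AE x in M. J (\<Union>i\<in>I. A i) x = (\<Sum>i\<in>I. J (A i) x)"
    using insert by (auto simp: disjoint_family_on_def)
  ultimately show ?case by eventually_elim (use insert in simp)
qed

lemma AE_funpow:
  assumes "AE x in M. P x"
  shows "AE x in M. P ((T ^^ i) x)"
proof (rule AE_distrD[OF funpow_measurable[OF T]])
  show "AE x in distr M M (T ^^ i). P x" unfolding funpow_distr[OF T] by fact
qed

lemma J_equivariant_funpow:
  assumes "Q \<in> sets N"
  shows "AE x in M. J ((S ^^ i) -` Q \<inter> space N) x = J Q ((T ^^ i) x)"
proof (induction i)
  case 0
  have "Q \<inter> space N = Q" using sets.sets_into_space[OF assms] by auto
  then show ?case by simp
next
  case (Suc i)
  let ?Q = "(S ^^ i) -` Q \<inter> space N"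
  have "?Q \<in> sets N" using funpow_measurable[OF S] assms by (rule measurable_sets)
  then have "AE x in M. J (S -` ?Q \<inter> space N) x = J ?Q (T x)" by (rule J_equivariant)
  moreover have "S -` ?Q \<inter> space N = (S ^^ Suc i) -` Q \<inter> space N"
    using measurable_space[OF mp_automorphism_measurable[OF S]]
    by (auto simp: funpow_Suc_right simp del: funpow.simps)
  moreover define Q' where "Q' = (S ^^ Suc i) -` Q \<inter> space N"
  ultimately have "AE x in M. J Q' x = J ?Q (T x)" by (simp only:)
  moreover have "AE x in M. J ?Q (T x) = J Q ((T ^^ i) (T x))"
    using AE_funpow[OF Suc, of 1] by simp
  ultimately show ?case
    unfolding Q'_def[symmetric] by eventually_elim (simp add: funpow_swap1)
qed

text \<open>Where \<open>J Q\<close> is at some distance from \<open>c\<close>, the frequency of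
  \<open>Q\<close> among many draws detects the side with high probability. As \<open>J Q\<close>
  almost never equals \<open>c\<close>, a small enough distance leaves out few points.\<close>

lemma superlevel_set_pinsker:
  assumes Q: "Q \<in> sets N" and zero: "zero_entropy N S (\<lambda>y. y \<in> Q)"
    and c: "measure M {x \<in> space M. J Q x = c} = 0"
  shows "{x \<in> space M. c < J Q x} \<in> pinsker M T"
proof -
  interpret M: prob_space M using T by (rule mp_automorphism_prob_space)
  define P where "P = {x \<in> space M. c < J Q x}"
  have JQ [measurable]: "J Q \<in> borel_measurable M" using J_integrable[OF Q] by simp
  have P: "P \<in> sets M" unfolding P_def by measurable
  note p = simple_function_mem[OF P] and q = simple_function_mem[OF Q]
  have "zero_entropy M T (\<lambda>x. x \<in> P)"
    unfolding zero_entropy_def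
  proof (intro allI impI)
    fix \<epsilon> :: real assume "0 < \<epsilon>"
    then obtain \<delta> where \<delta>: "0 < \<delta>"
      "\<And>(K :: ('a \<times> bool list list) measure) E. prob_space K \<Longrightarrow> E \<in> sets K \<Longrightarrow> measure K E \<le> \<delta> \<Longrightarrow>
        partition_entropy K (\<lambda>x. x \<in> E) \<le> \<epsilon> / 2"
      using partition_entropy_small_event[of "\<epsilon> / 2"] by (metis half_gt_zero)
    \<comment> \<open>The undecided bands, in which the frequency need not tell the side of
      \<open>c\<close>. They decrease to the level set of \<open>c\<close>, a null set, so one of
      them has measure below \<open>\<delta> / 2\<close>.\<close>
    define A where "A k = {x \<in> space M. \<bar>J Q x - c\<bar> \<le> 1 / real (Suc k)}" for k
    have A_sets: "A k \<in> sets M" for k unfolding A_def by measurable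
    have "(\<lambda>k. M.prob (A k)) \<longlonglongrightarrow> M.prob (\<Inter>k. A k)"
    proof (intro M.finite_Lim_measure_decseq)
      show "decseq A"
        unfolding decseq_def A_def by (auto intro: order_trans simp: frac_le)
    qed (use A_sets in auto)
    moreover have "(\<Inter>k. A k) = {x \<in> space M. J Q x = c}"
    proof -
      have "J Q x = c" if "\<And>k. \<bar>J Q x - c\<bar> \<le> 1 / real (Suc k)" for x
      proof (rule ccontr)
        assume "J Q x \<noteq> c"
        then obtain k where "inverse (real (Suc k)) < \<bar>J Q x - c\<bar>"
          using reals_Archimedean[of "\<bar>J Q x - c\<bar>"] by auto
        with that[of k] show False by (simp add: inverse_eq_divide)
      qed
      then show ?thesis by (auto simp: A_def)
    qed
    ultimately have "(\<lambda>k. M.prob (A k)) \<longlonglongrightarrow> 0" using c by simp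
    then have "\<forall>\<^sub>F k in sequentially. M.prob (A k) < \<delta> / 2"
      using \<delta>(1) by (intro order_tendstoD) auto
    then obtain k where k: "M.prob (A k) < \<delta> / 2"
      using eventually_happens'[OF sequentially_bot] by blast
    define d where "d = 1 / real (Suc k)"
    have d: "0 < d" by (simp add: d_def)
    \<comment> \<open>The 8 is twice the 4 of the weak law: a large deviation gets probability at
      most \<open>\<delta> / 2\<close>, the other half being used by the band. The choice is made
      before \<open>n\<close>.\<close>
    obtain m :: nat where m0: "8 / (\<delta> * d\<^sup>2) < real m" using reals_Archimedean2 by blast
    have "0 < 8 / (\<delta> * d\<^sup>2)" using \<delta>(1) d by simp
    then have "0 < real m" using m0 by linarith
    with m0 have m: "0 < m" "4 / (real m * d\<^sup>2) \<le> \<delta> / 2"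
      using \<delta>(1) d by (simp_all add: field_simps)
    \<comment> \<open>Each of the \<open>m\<close> itineraries gets an equal share of
      \<open>\<epsilon> / 2\<close>.\<close>
    have "0 < \<epsilon> / (2 * real m)" using m \<open>0 < \<epsilon>\<close> by simp
    then obtain n where n: "0 < n"
      "partition_entropy N (itinerary S (\<lambda>y. y \<in> Q) n) \<le> \<epsilon> / (2 * real m) * real n"
      using zero unfolding zero_entropy_def by blast
    define B where "B = words (UNIV :: bool set) n"
    have B: "finite B" unfolding B_def by (intro finite_lists_length_eq) simp
    define R where "R b = itinerary S (\<lambda>y. y \<in> Q) n -` {b} \<inter> space N" for b
    have R: "R b \<in> sets N" for b
      unfolding R_def by (rule simple_functionD(2)[OF simple_function_itinerary[OF S q]])
    have disj: "disjoint_family_on R X" for X by (auto simp: disjoint_family_on_def R_def)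
    \<comment> \<open>Letter \<open>i\<close> of an itinerary records \<open>Q\<close> at time
      \<open>i\<close>, so the same atoms compute the conditional probability of \<open>Q\<close> at
      every time below \<open>n\<close>.\<close>
    have UN_R: "(\<Union>b\<in>{b \<in> B. b ! i}. R b) = (S ^^ i) -` Q \<inter> space N" if "i < n" for i
      using that by (auto simp: R_def B_def itinerary_def)
    have UN_B: "(\<Union>b\<in>B. R b) = space N"
      by (auto simp: R_def B_def itinerary_def)
    let ?\<psi> = "\<lambda>b. J (R b)"
    interpret C: conditional_copies M B ?\<psi> m
    proof
      show "AE x in M. (\<Sum>b\<in>B. J (R b) x) = 1"
        using J_finite_UN[OF B R disj] J_space by eventually_elim (simp add: UN_B)
    qed (use J_integrable[OF R] J_nonneg[OF R] B in auto)
    note K = C.prob_space_copies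
    \<comment> \<open>The frequency of \<open>Q\<close> at time \<open>i\<close> among the drawn
      itineraries. By equivariance its conditional mean is \<open>J Q ((T ^^ i) x)\<close> for
      almost every \<open>x\<close>.\<close>
    define Z where "Z i bs = (\<Sum>b\<leftarrow>bs. of_bool (b ! i)) / real m" for i and bs :: "bool list list"
    define E where "E i = {z \<in> space C.C. ((T ^^ i) (fst z) \<in> P) \<noteq> (c < Z i (snd z))}" for i
    have E: "E i \<in> sets C.C" for i
    proof -
      have "simple_function C.C (\<lambda>z. ((T ^^ i) (fst z) \<in> P, c < Z i (snd z)))"
        by (intro simple_function_Pair C.simple_function_copies_snd
            C.simple_function_copies_fst[where f = "\<lambda>x. (T ^^ i) x \<in> P"] simple_function_funpow[OF T p])
      then have "(\<lambda>z. ((T ^^ i) (fst z) \<in> P, c < Z i (snd z))) -` {(True, False), (False, True)} \<inter> space C.C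
        \<in> sets C.C" by (rule simple_functionD(2))
      moreover have "(\<lambda>z. ((T ^^ i) (fst z) \<in> P, c < Z i (snd z))) -` {(True, False), (False, True)} \<inter> space C.C
        = E i" by (auto simp: E_def)
      ultimately show ?thesis by simp
    qed
    have E_small: "measure C.C (E i) \<le> \<delta>" if i: "i < n" for i
    proof -
      interpret K: prob_space C.C by (rule K)
      define D where "D = {z \<in> space C.C. d < \<bar>Z i (snd z) - J Q ((T ^^ i) (fst z))\<bar>}"
      define A' where "A' = ((T ^^ i) -` A k \<inter> space M) \<times> words B m"
      have Ti: "(\<lambda>x. J Q ((T ^^ i) x)) \<in> borel_measurable M"
        using measurable_compose[OF funpow_measurable[OF T] JQ] .
      have A'0: "(T ^^ i) -` A k \<inter> space M \<in> sets M"
        using funpow_measurable[OF T] A_sets by (rule measurable_sets)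
      have A': "A' \<in> sets C.C" using A'0 by (simp add: A'_def C.sets_copies)
      have D: "D \<in> sets C.C"
      proof -
        have "(\<lambda>z. Z i (snd z) - J Q ((T ^^ i) (fst z))) \<in> borel_measurable C.C"
          by (rule C.measurable_copiesI) (use Ti in simp)
        then show ?thesis unfolding D_def by measurable
      qed
      \<comment> \<open>Outside the band the value differs from \<open>c\<close> by more than
        \<open>d\<close>, so a frequency on the wrong side of \<open>c\<close> deviates from the
        value by more than \<open>d\<close>.\<close>
      have "E i \<subseteq> A' \<union> D"
      proof
        fix z assume z: "z \<in> E i"
        then have sp: "fst z \<in> space M" "snd z \<in> words B m" "z \<in> space C.C"
          by (auto simp: E_def C.space_copies)
        have "(T ^^ i) (fst z) \<in> space M" using sp(1) by (rule funpow_space[OF T])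
        moreover from this have "(c < J Q ((T ^^ i) (fst z))) \<noteq> (c < Z i (snd z))"
          using z by (simp add: E_def P_def)
        ultimately show "z \<in> A' \<union> D"
          using sp by (auto simp: A'_def A_def D_def d_def mem_Times_iff)
      qed
      then have "K.prob (E i) \<le> K.prob (A' \<union> D)"
        using A' D by (intro K.finite_measure_mono) auto
      also have "\<dots> \<le> K.prob A' + K.prob D"
        using A' D by (rule measure_Un_le)
      also have "K.prob A' = M.prob (A k)"
        using C.emeasure_copies_fst[OF A'0] measure_funpow[OF T A_sets[of k], of i]
        by (simp add: A'_def measure_def)
      also have "K.prob D \<le> 4 / (real m * d\<^sup>2)"
        unfolding D_def Z_def
      proof (rule C.weak_law_copies[OF _ Ti _ d m(1)])
        have "AE x in M. J ((S ^^ i) -` Q \<inter> space N) x = (\<Sum>b | b \<in> B \<and> b ! i. J (R b) x)"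
          using J_finite_UN[of "{b \<in> B. b ! i}" R, OF _ R disj] B by (simp add: UN_R[OF i])
        then show "AE x in M. (\<Sum>b\<in>B. J (R b) x * of_bool (b ! i)) = J Q ((T ^^ i) x)"
          using J_equivariant_funpow[OF Q, of i]
        proof eventually_elim
          case (elim x)
          then show ?case using B by (simp add: sum.If_cases of_bool_def Int_def if_distrib cong: if_cong)
        qed
      qed simp
      finally show ?thesis using k m by simp
    qed
    \<comment> \<open>Subadditivity over the \<open>m\<close> letters, each of which has the law of
      the itinerary.\<close>
    have bs: "partition_entropy C.C snd \<le> real m * partition_entropy N (itinerary S (\<lambda>y. y \<in> Q) n)"
    proof -
      have nth: "partition_entropy C.C (\<lambda>z. snd z ! j) = partition_entropy N (itinerary S (\<lambda>y. y \<in> Q) n)"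
        if j: "j < m" for j
      proof (intro partition_entropy_cong_distribution K mp_automorphism_prob_space[OF S]
          simple_function_itinerary[OF S q] C.simple_function_copies_snd)
        fix b
        have vim: "(\<lambda>z. snd z ! j) -` {b} \<inter> space C.C = {z \<in> space C.C. snd z ! j = b}" by auto
        show "measure C.C ((\<lambda>z. snd z ! j) -` {b} \<inter> space C.C)
          = measure N (itinerary S (\<lambda>y. y \<in> Q) n -` {b} \<inter> space N)"
        proof (cases "b \<in> B")
          case True
          then show ?thesis
            using C.measure_copies_nth[OF j True J_integrable[OF R]] J_integral[OF R]
            unfolding vim by (simp add: R_def)
        next
          \<comment> \<open>A word outside \<open>B\<close> has the wrong length and occurs on
            neither side.\<close>
          case False
          have "R b = {}" using False by (auto simp: R_def B_def itinerary_def)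
          moreover have "{z \<in> space C.C. snd z ! j = b} = {}"
            using False j nth_mem by (fastforce simp: C.space_copies)
          ultimately show ?thesis by (simp only: vim R_def[symmetric] measure_empty)
        qed
      qed
      have "partition_entropy C.C snd \<le> partition_entropy C.C (\<lambda>z. map (\<lambda>j. snd z ! j) [0..<m])"
        by (rule partition_entropy_le[where f = "\<lambda>v. v"])
          (auto simp: K C.space_copies map_nth intro!: simple_function_map C.simple_function_copies_snd
            C.simple_function_copies_snd[of "\<lambda>v. v", simplified])
      also have "\<dots> \<le> (\<Sum>j\<leftarrow>[0..<m]. partition_entropy C.C (\<lambda>z. snd z ! j))"
        by (intro partition_entropy_map K C.simple_function_copies_snd)
      also have "\<dots> = (\<Sum>j\<leftarrow>[0..<m]. partition_entropy N (itinerary S (\<lambda>y. y \<in> Q) n))"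
        by (intro arg_cong[where f = sum_list] map_cong refl nth) auto
      finally show ?thesis by (simp add: sum_list_triv)
    qed
    have "partition_entropy M (itinerary T (\<lambda>x. x \<in> P) n)
      = partition_entropy C.C (\<lambda>z. itinerary T (\<lambda>x. x \<in> P) n (fst z))"
      by (rule C.partition_entropy_copies_fst[symmetric]) (rule simple_function_itinerary[OF T p])
    \<comment> \<open>Decoding: the labels give the frequencies, and the error bits tell at which
      times the comparison with \<open>c\<close> must be flipped.\<close>
    also have "\<dots> \<le> partition_entropy C.C snd + partition_entropy C.C (\<lambda>z. map (\<lambda>i. z \<in> E i) [0..<n])"
      by (rule partition_entropy_le_add[where f = "\<lambda>bs es. map (\<lambda>i. (c < Z i bs) \<noteq> es ! i) [0..<n]"])
        (use K E C.simple_function_copies_fst[OF simple_function_itinerary[OF T p]]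
            C.simple_function_copies_snd[of "\<lambda>v. v"] simple_function_map[OF simple_function_mem[OF E]] in
          \<open>auto simp: E_def itinerary_def\<close>)
    also have "partition_entropy C.C (\<lambda>z. map (\<lambda>i. z \<in> E i) [0..<n])
      \<le> (\<Sum>i\<leftarrow>[0..<n]. partition_entropy C.C (\<lambda>z. z \<in> E i))"
      by (intro partition_entropy_map K simple_function_mem E)
    also have "\<dots> \<le> (\<Sum>i\<leftarrow>[0..<n]. \<epsilon> / 2)"
      using \<delta>(2)[OF K E E_small] by (intro sum_list_mono) auto
    also note bs
    also have "real m * partition_entropy N (itinerary S (\<lambda>y. y \<in> Q) n) + (\<Sum>i\<leftarrow>[0..<n]. \<epsilon> / 2)
      \<le> real m * (\<epsilon> / (2 * real m) * real n) + real n * (\<epsilon> / 2)"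
      using n(2) by (intro add_mono mult_left_mono) (auto simp: sum_list_triv)
    also have "\<dots> = \<epsilon> * real n" using m(1) by (simp add: field_simps)
    finally show "\<exists>n>0. partition_entropy M (itinerary T (\<lambda>x. x \<in> P) n) \<le> \<epsilon> * real n"
      using n(1) by auto
  qed
  then show ?thesis using P by (simp add: pinsker_def P_def)
qed

text \<open>The law of \<open>J Q\<close> has countably many atoms, so admissible levels are dense.
  Their superlevel sets are trivial, and the mean decides which are null and which are full; this
  squeezes \<open>J Q\<close> to its mean.\<close>

lemma J_constant:
  assumes K: "kolmogorov M T" and Q: "Q \<in> sets N" and zero: "zero_entropy N S (\<lambda>y. y \<in> Q)"
  shows "AE x in M. J Q x = measure N Q"
proof -
  interpret M: prob_space M using T by (rule mp_automorphism_prob_space)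
  have int: "integrable M (J Q)" using J_integrable[OF Q] .
  then have JQ [measurable]: "J Q \<in> borel_measurable M" by simp
  interpret D: finite_measure "distr M borel (J Q)"
    by (rule M.finite_measure_distr) simp
  have "countable {c. measure (distr M borel (J Q)) {c} \<noteq> 0}"
    by (rule D.countable_support)
  then have countable: "countable {c. M.prob {x \<in> space M. J Q x = c} \<noteq> 0}"
    by (simp add: measure_distr vimage_def Int_def conj_commute)
  have good: "\<exists>c. a < c \<and> c < b \<and> M.prob {x \<in> space M. J Q x = c} = 0" if "a < b" for a b :: real
  proof -
    have "\<not> {a<..<b} \<subseteq> {c. M.prob {x \<in> space M. J Q x = c} \<noteq> 0}"
      using uncountable_open_interval[of a b] that countable_subset[OF _ countable] by blast
    then show ?thesis by auto
  qed
  have trivial: "M.prob {x \<in> space M. c < J Q x} = 0 \<or> M.prob {x \<in> space M. c < J Q x} = 1"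
    if "M.prob {x \<in> space M. J Q x = c} = 0" for c
    using kolmogorov_pinsker_trivial[OF T K superlevel_set_pinsker[OF Q zero that]] .
  define e where "e = measure N Q"
  have e: "(\<integral>x. J Q x \<partial>M) = e" using J_integral[OF Q] by (simp add: e_def)
  have lower: "AE x in M. a \<le> J Q x" if a: "a < e" for a
  proof -
    obtain c where c: "a < c" "c < e" "M.prob {x \<in> space M. J Q x = c} = 0" using good[OF a] by blast
    have "M.prob {x \<in> space M. c < J Q x} \<noteq> 0"
    proof
      assume "M.prob {x \<in> space M. c < J Q x} = 0"
      then have "AE x in M. J Q x \<le> c"
        by (intro AE_I[of _ _ "{x \<in> space M. c < J Q x}"]) (auto simp: M.emeasure_eq_measure)
      then have "(\<integral>x. J Q x \<partial>M) \<le> (\<integral>x. c \<partial>M)" using int by (intro integral_mono_AE) auto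
      with c(2) e show False by (simp add: M.prob_space)
    qed
    then have "AE x in M. x \<in> {x \<in> space M. c < J Q x}"
      using trivial[OF c(3)] by (intro M.AE_prob_1) simp
    then show ?thesis by eventually_elim (use c(1) in simp)
  qed
  have upper: "AE x in M. J Q x \<le> b" if b: "e < b" for b
  proof -
    obtain c where c: "e < c" "c < b" "M.prob {x \<in> space M. J Q x = c} = 0" using good[OF b] by blast
    have "M.prob {x \<in> space M. c < J Q x} \<noteq> 1"
    proof
      assume "M.prob {x \<in> space M. c < J Q x} = 1"
      then have "AE x in M. c \<le> J Q x"
        by (auto dest!: M.AE_prob_1 elim: AE_mp)
      then have "(\<integral>x. c \<partial>M) \<le> (\<integral>x. J Q x \<partial>M)" using int by (intro integral_mono_AE) auto
      with c(1) e show False by (simp add: M.prob_space)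
    qed
    then have "M.prob {x \<in> space M. c < J Q x} = 0" using trivial[OF c(3)] by simp
    then have "AE x in M. J Q x \<le> c"
      by (intro AE_I[of _ _ "{x \<in> space M. c < J Q x}"]) (auto simp: M.emeasure_eq_measure)
    then show ?thesis by eventually_elim (use c(2) in simp)
  qed
  \<comment> \<open>Countably many bounds, so that their exceptional null sets can be
    united.\<close>
  have "AE x in M. \<forall>k. e - inverse (real (Suc k)) \<le> J Q x \<and> J Q x \<le> e + inverse (real (Suc k))"
    unfolding AE_all_countable using lower upper by (auto intro!: AE_conjI)
  then show ?thesis
  proof eventually_elim
    case (elim x)
    have "e \<le> J Q x + \<eta>" "J Q x \<le> e + \<eta>" if eta: "0 < \<eta>" for \<eta>
    proof -
      obtain k where "inverse (real (Suc k)) < \<eta>" using reals_Archimedean[OF eta] by blast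
      with elim[rule_format, of k] show "e \<le> J Q x + \<eta>" "J Q x \<le> e + \<eta>" by linarith+
    qed
    then show ?case unfolding e_def[symmetric] by (meson field_le_epsilon order_antisym)
  qed
qed

end

section \<open>Markov operators\<close>

lemma L2_indicator:
  assumes "prob_space M" "A \<in> sets M"
  shows "indicator A \<in> L2 M"
proof -
  interpret prob_space M by fact
  have "(\<lambda>x. (cmod (indicator A x))\<^sup>2) = (indicator A :: 'a \<Rightarrow> real)"
    by (auto simp: indicator_def fun_eq_iff)
  then show ?thesis using assms(2) by (simp add: L2_def emeasure_eq_measure)
qed

lemma L2_const: "prob_space M \<Longrightarrow> (\<lambda>_. c) \<in> L2 M"
  by (simp add: L2_def prob_space_def finite_measure.integrable_const)

lemma L2_integrable:
  assumes "prob_space M" "f \<in> L2 M"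
  shows "integrable M f"
proof -
  interpret prob_space M by fact
  show ?thesis
  proof (rule Bochner_Integration.integrable_bound)
    show "integrable M (\<lambda>x. 1 + (cmod (f x))\<^sup>2)" using assms(2) by (simp add: L2_def)
    have "cmod z \<le> 1 + (cmod z)\<^sup>2" for z
      using zero_le_power2[of "cmod z - 1 / 2"] by (simp add: power2_eq_square algebra_simps)
    then show "AE x in M. cmod (f x) \<le> norm (1 + (cmod (f x))\<^sup>2)" by simp
  qed (use assms(2) in \<open>simp add: L2_def\<close>)
qed

lemma L2_operator_closed: "L2_operator M N \<Phi> \<Longrightarrow> f \<in> L2 M \<Longrightarrow> \<Phi> f \<in> L2 N"
  by (simp add: L2_operator_def)

lemma L2_operator_cong:
  "L2_operator M N \<Phi> \<Longrightarrow> f \<in> L2 M \<Longrightarrow> g \<in> L2 M \<Longrightarrow> AE x in M. f x = g x \<Longrightarrow>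
    AE y in N. \<Phi> f y = \<Phi> g y"
  by (simp add: L2_operator_def)

lemma integral_mp_automorphism:
  fixes f :: "'a \<Rightarrow> 'b :: {banach, second_countable_topology}"
  assumes "mp_automorphism M T" "f \<in> borel_measurable M"
  shows "(\<integral>x. f (T x) \<partial>M) = (\<integral>x. f x \<partial>M)"
  using integral_distr[OF mp_automorphism_measurable[OF assms(1)] assms(2)] assms(1)
  by (simp add: mp_automorphism_def)

text \<open>As \<open>h\<close> is bounded by 1, it remains to compare the squared mean of
  \<open>cmod (u x)\<close> with the mean of its square, which is nonnegativity of a
  variance.\<close>

lemma norm_integral_le_L2_norm:
  assumes "prob_space M" "u \<in> L2 M" "h \<in> borel_measurable M" "\<And>x. cmod (h x) \<le> 1"
  shows "cmod (\<integral>x. u x * h x \<partial>M) \<le> L2_norm M u"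
proof -
  interpret prob_space M by fact
  have u: "integrable M (\<lambda>x. cmod (u x))" "integrable M (\<lambda>x. (cmod (u x))\<^sup>2)"
    using L2_integrable[OF assms(1,2)] assms(2) by (auto simp: L2_def)
  have "cmod (\<integral>x. u x * h x \<partial>M) \<le> (\<integral>x. cmod (u x * h x) \<partial>M)" by (rule integral_norm_bound)
  also have "\<dots> \<le> (\<integral>x. cmod (u x) \<partial>M)"
  proof (intro integral_mono u)
    show "cmod (u x * h x) \<le> cmod (u x)" for x
      using assms(4)[of x] by (simp add: norm_mult mult_left_le)
    show "integrable M (\<lambda>x. cmod (u x * h x))"
      using assms(2-4) by (intro Bochner_Integration.integrable_bound[OF u(1)])
        (auto simp: L2_def norm_mult mult_left_le)
  qed
  also have "\<dots> \<le> L2_norm M u"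
  proof -
    have "0 \<le> variance (\<lambda>x. cmod (u x))" by (rule variance_positive)
    then have "(\<integral>x. cmod (u x) \<partial>M)\<^sup>2 \<le> (\<integral>x. (cmod (u x))\<^sup>2 \<partial>M)"
      using variance_eq[OF u] by simp
    then show ?thesis unfolding L2_norm_def by (rule real_le_rsqrt)
  qed
  finally show ?thesis .
qed

lemma markov_quasi_image_kolmogorov:
  assumes T1: "mp_automorphism M1 T1" and T2: "mp_automorphism M2 T2"
    and image: "markov_quasi_image M2 T2 M1 T1" and K: "kolmogorov M1 T1"
  shows "kolmogorov M2 T2"
  unfolding kolmogorov_def trivial_factor_def
proof (intro allI impI ballI)
  fix F A
  assume F: "factor_algebra M2 T2 F \<and> ks_entropy (restr_to_subalg M2 F) T2 = 0" and A: "A \<in> sets F"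
  interpret M1: prob_space M1 using T1 by (rule mp_automorphism_prob_space)
  interpret M2: prob_space M2 using T2 by (rule mp_automorphism_prob_space)
  note P1 = M1.prob_space_axioms and P2 = M2.prob_space_axioms
  obtain \<Phi> where markov: "markov_operator M1 M2 \<Phi>" and dense: "L2_dense_range M1 M2 \<Phi>"
    and intertwine: "\<And>f. f \<in> L2 M1 \<Longrightarrow> AE y in M2. \<Phi> (koopman T1 f) y = koopman T2 (\<Phi> f) y"
    using image unfolding markov_quasi_image_def by blast
  have \<Phi>: "L2_operator M1 M2 \<Phi>" and \<Phi>_1: "AE y in M2. \<Phi> (\<lambda>x. 1) y = 1"
    and \<Phi>_nonneg: "\<And>f. f \<in> L2 M1 \<Longrightarrow> AE x in M1. f x \<in> nonneg_Reals \<Longrightarrow> AE y in M2. \<Phi> f y \<in> nonneg_Reals"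
    using markov unfolding markov_operator_def by blast+
  obtain \<Psi> where \<Psi>: "L2_operator M2 M1 \<Psi>" and \<Psi>_1: "AE x in M1. \<Psi> (\<lambda>y. 1) x = 1"
    and adjoint: "\<And>f g. f \<in> L2 M1 \<Longrightarrow> g \<in> L2 M2 \<Longrightarrow> L2_inner M2 (\<Phi> f) g = L2_inner M1 f (\<Psi> g)"
    using markov unfolding markov_operator_def L2_adjoint_def by blast
  note ind1 = L2_indicator[OF P1] and ind2 = L2_indicator[OF P2]
  note \<Phi>_ind = L2_operator_closed[OF \<Phi> ind1] and \<Psi>_ind = L2_operator_closed[OF \<Psi> ind2]
  have \<Psi>_int: "integrable M1 (\<Psi> (indicator Q))" if "Q \<in> sets M2" for Q
    using \<Psi>_ind[OF that] by (rule L2_integrable[OF P1])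

  \<comment> \<open>The joining given by the Markov operator, and its conditional
    probabilities\<close>
  have adjoint_ind: "(\<integral>y. \<Phi> f y * indicator Q y \<partial>M2) = (\<integral>x. f x * cnj (\<Psi> (indicator Q) x) \<partial>M1)"
    if "f \<in> L2 M1" "Q \<in> sets M2" for f Q
  proof -
    have "cnj (indicator Q y) = indicator Q y" for y
      by (simp add: indicator_def)
    then show ?thesis using adjoint[OF that(1) ind2[OF that(2)]] by (simp add: L2_inner_def)
  qed
  \<comment> \<open>The left side is the mass of P x Q in the joining. The right side exhibits the
    real and imaginary parts of \<open>\<Psi> (indicator Q)\<close> as densities, to be tested on
    all \<open>P\<close>.\<close>
  have joint: "(\<integral>y. \<Phi> (indicator P) y * indicator Q y \<partial>M2)
      = Complex (\<integral>x\<in>P. Re (\<Psi> (indicator Q) x) \<partial>M1) (- (\<integral>x\<in>P. Im (\<Psi> (indicator Q) x) \<partial>M1))"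
    if "P \<in> sets M1" "Q \<in> sets M2" for P Q
  proof -
    have *: "indicator P x * cnj (\<Psi> (indicator Q) x)
        = cnj (indicator P x *\<^sub>R \<Psi> (indicator Q) x)" for x
      by (simp add: indicator_def)
    have "integrable M1 (\<lambda>x. indicator P x *\<^sub>R \<Psi> (indicator Q) x)"
      using \<Psi>_int[OF that(2)] that(1) by (rule integrable_mult_indicator[rotated])
    note parts = integral_Re[OF this] integral_Im[OF this]
    have "(\<integral>y. \<Phi> (indicator P) y * indicator Q y \<partial>M2)
        = cnj (\<integral>x. indicator P x *\<^sub>R \<Psi> (indicator Q) x \<partial>M1)"
      unfolding adjoint_ind[OF ind1[OF that(1)] that(2)] * by (rule Bochner_Integration.integral_cnj)
    with parts show ?thesis
      by (simp add: complex_eq_iff set_lebesgue_integral_def del: integral_Re integral_Im)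
  qed
  \<comment> \<open>Positivity is given for \<open>\<Phi>\<close>. It passes to the joining here,
    and from there to \<open>\<Psi>\<close> by the choice of test sets \<open>P\<close>.\<close>
  have joint_nonneg: "(\<integral>y. \<Phi> (indicator P) y * indicator Q y \<partial>M2) \<in> nonneg_Reals"
    if "P \<in> sets M1" "Q \<in> sets M2" for P Q
  proof -
    have "AE y in M2. \<Phi> (indicator P) y \<in> nonneg_Reals"
      using \<Phi>_nonneg[OF ind1[OF that(1)]] by (simp add: indicator_def)
    then have ae: "AE y in M2. \<Phi> (indicator P) y * indicator Q y
        = complex_of_real (Re (\<Phi> (indicator P) y) * indicator Q y) \<and>
        0 \<le> Re (\<Phi> (indicator P) y) * indicator Q y"
      by eventually_elim (auto simp: complex_nonneg_Reals_iff complex_eq_iff indicator_def)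
    then have "(\<integral>y. \<Phi> (indicator P) y * indicator Q y \<partial>M2)
        = (\<integral>y. complex_of_real (Re (\<Phi> (indicator P) y) * indicator Q y) \<partial>M2)"
      using \<Phi>_ind[OF that(1)] that(2) by (intro integral_cong_AE) (auto simp: L2_def)
    also have "\<dots> = complex_of_real (\<integral>y. Re (\<Phi> (indicator P) y) * indicator Q y \<partial>M2)"
      by (rule integral_complex_of_real)
    finally show ?thesis using ae by (simp add: integral_nonneg_AE)
  qed
  \<comment> \<open>By \<open>Im_0\<close> below, taking the real part changes
    \<open>\<Psi> (indicator Q)\<close> only on a null set.\<close>
  define J where "J Q x = Re (\<Psi> (indicator Q) x)" for Q x
  have J_int: "integrable M1 (J Q)" if "Q \<in> sets M2" for Q
    unfolding J_def using \<Psi>_int[OF that] by simp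
  have J_joint: "(\<integral>x\<in>P. J Q x \<partial>M1) = Re (\<integral>y. \<Phi> (indicator P) y * indicator Q y \<partial>M2)"
    if "P \<in> sets M1" "Q \<in> sets M2" for P Q
    using joint[OF that] by (simp add: J_def)
  have Im_0: "AE x in M1. Im (\<Psi> (indicator Q) x) = 0" if Q: "Q \<in> sets M2" for Q
  proof (rule density_unique_real)
    show "integrable M1 (\<lambda>x. Im (\<Psi> (indicator Q) x))" using \<Psi>_int[OF Q] by simp
    show "(\<integral>x\<in>P. Im (\<Psi> (indicator Q) x) \<partial>M1) = (\<integral>x\<in>P. 0 \<partial>M1)" if "P \<in> sets M1" for P
      using joint_nonneg[OF that Q] joint[OF that Q] by (simp add: complex_nonneg_Reals_iff)
  qed simp
  have J_nonneg: "AE x in M1. 0 \<le> J Q x" if Q: "Q \<in> sets M2" for Q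
  proof -
    \<comment> \<open>Testing on the set where the claim fails: the integral of \<open>J Q\<close>
      over it is both nonnegative and nonpositive.\<close>
    define P where "P = {x \<in> space M1. J Q x < 0}"
    have [measurable]: "J Q \<in> borel_measurable M1" using J_int[OF Q] by simp
    have P: "P \<in> sets M1" unfolding P_def by measurable
    have le: "0 \<le> (\<integral>x\<in>P. J Q x \<partial>M1)"
      using joint_nonneg[OF P Q] J_joint[OF P Q] by (simp add: complex_nonneg_Reals_iff)
    have int: "integrable M1 (\<lambda>x. - (indicator P x * J Q x))"
      using integrable_mult_indicator[OF P J_int[OF Q]] by simp
    have pos: "0 \<le> - (indicator P x * J Q x)" for x by (auto simp: P_def indicator_def)
    have "(\<integral>x. - (indicator P x * J Q x) \<partial>M1) \<le> 0"
      using le by (simp add: set_lebesgue_integral_def)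
    moreover have "0 \<le> (\<integral>x. - (indicator P x * J Q x) \<partial>M1)"
      by (intro integral_nonneg_AE AE_I2 pos)
    ultimately have "(\<integral>x. - (indicator P x * J Q x) \<partial>M1) = 0" by (rule order_antisym)
    then have "AE x in M1. - (indicator P x * J Q x) = 0"
      using integral_nonneg_eq_0_iff_AE[OF int] pos by simp
    then show ?thesis using AE_space
      by eventually_elim (auto simp: P_def indicator_def split: if_splits)
  qed
  have J_space: "AE x in M1. J (space M2) x = 1"
  proof -
    have "AE x in M1. \<Psi> (indicator (space M2)) x = \<Psi> (\<lambda>y. 1) x"
      by (intro L2_operator_cong[OF \<Psi>] ind2 L2_const[OF P2]) (auto intro: AE_I2)
    then show ?thesis using \<Psi>_1 by eventually_elim (simp add: J_def)
  qed
  have J_Un: "AE x in M1. J (A \<union> B) x = J A x + J B x"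
    if "A \<in> sets M2" "B \<in> sets M2" "A \<inter> B = {}" for A B
  proof -
    have eq: "indicator (A \<union> B) = (\<lambda>y. indicator A y + indicator B y :: complex)"
      using that(3) by (auto simp: indicator_def fun_eq_iff)
    have "AE x in M1. \<Psi> (\<lambda>y. indicator A y + indicator B y) x
        = \<Psi> (indicator A) x + \<Psi> (indicator B) x"
      using \<Psi> ind2 that unfolding L2_operator_def by blast
    then show ?thesis unfolding J_def eq by eventually_elim simp
  qed
  \<comment> \<open>Taking adjoints in the intertwining relation produces the inverses of the
    Koopman operators. Invertibility is therefore used on the test set: \<open>P\<close> is replaced
    by its image \<open>P'\<close> under \<open>T1\<close>, and
    \<open>indicator P' \<circ> T1\<close> agrees with \<open>indicator P\<close> on the
    space.\<close>
  have J_equivariant: "AE x in M1. J (T2 -` Q \<inter> space M2) x = J Q (T1 x)" if Q: "Q \<in> sets M2" for Q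
  proof (rule density_unique_real)
    note T1m = mp_automorphism_measurable[OF T1] and T2m = mp_automorphism_measurable[OF T2]
    have Q': "T2 -` Q \<inter> space M2 \<in> sets M2" using T2m Q by (rule measurable_sets)
    then show "integrable M1 (J (T2 -` Q \<inter> space M2))" by (rule J_int)
    have "integrable (distr M1 M1 T1) (J Q)" using J_int[OF Q] T1 by (simp add: mp_automorphism_def)
    then show "integrable M1 (\<lambda>x. J Q (T1 x))" using T1m by (rule integrable_distr[rotated])
    fix P assume P: "P \<in> sets M1"
    define P' where "P' = inv_into (space M1) T1 -` P \<inter> space M1"
    have P': "P' \<in> sets M1"
      unfolding P'_def using T1 P by (auto simp: mp_automorphism_def intro: measurable_sets)
    have ind: "indicator P' (T1 x) = indicator P x" if "x \<in> space M1" for x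
      using that T1 measurable_space[OF T1m that]
      by (auto simp: P'_def mp_automorphism_def bij_betw_def indicator_def)
    have koop: "AE y in M2. \<Phi> (indicator P) y = \<Phi> (indicator P') (T2 y)"
    proof -
      have eq: "AE x in M1. koopman T1 (indicator P') x = indicator P x"
        by (rule AE_I2) (simp add: koopman_def ind)
      have "AE y in M2. \<Phi> (koopman T1 (indicator P')) y = \<Phi> (indicator P) y"
      proof (rule L2_operator_cong[OF \<Phi> _ ind1[OF P] eq])
        have "koopman T1 (indicator P') = indicator (T1 -` P')"
          by (auto simp: koopman_def indicator_def fun_eq_iff)
        moreover have "koopman T1 (indicator P') \<in> borel_measurable M1"
          unfolding koopman_def by (rule measurable_comp[OF T1m]) (use P' in simp)
        moreover have "(\<lambda>x. (cmod (koopman T1 (indicator P') x))\<^sup>2) \<in> borel_measurable M1"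
          using calculation(2) by measurable
        ultimately show "koopman T1 (indicator P') \<in> L2 M1"
          unfolding L2_def by (auto intro!: M1.integrable_const_bound[where B = 1] simp: indicator_def)
      qed
      then show ?thesis
        using intertwine[OF ind1[OF P']] by eventually_elim (simp add: koopman_def)
    qed
    have "(\<integral>x\<in>P. J Q (T1 x) \<partial>M1) = (\<integral>x. indicator P' (T1 x) * J Q (T1 x) \<partial>M1)"
      unfolding set_lebesgue_integral_def by (intro Bochner_Integration.integral_cong) (auto simp: ind)
    also have "\<dots> = (\<integral>x. indicator P' x * J Q x \<partial>M1)"
      using J_int[OF Q] P' by (intro integral_mp_automorphism[OF T1]) simp
    also have "\<dots> = Re (\<integral>y. \<Phi> (indicator P') y * indicator Q y \<partial>M2)"
      using J_joint[OF P' Q] by (simp add: set_lebesgue_integral_def)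
    also have "(\<integral>y. \<Phi> (indicator P') y * indicator Q y \<partial>M2)
        = (\<integral>y. \<Phi> (indicator P') (T2 y) * indicator Q (T2 y) \<partial>M2)"
      using \<Phi>_ind[OF P'] Q
      by (intro integral_mp_automorphism[OF T2, where f = "\<lambda>y. \<Phi> (indicator P') y * indicator Q y", symmetric])
        (auto simp: L2_def)
    also have "\<dots> = (\<integral>y. \<Phi> (indicator P) y * indicator (T2 -` Q \<inter> space M2) y \<partial>M2)"
    proof (rule integral_cong_AE)
      have "\<Phi> (indicator P') \<in> borel_measurable M2" using \<Phi>_ind[OF P'] by (simp add: L2_def)
      then show "(\<lambda>y. \<Phi> (indicator P') (T2 y) * indicator Q (T2 y)) \<in> borel_measurable M2"
        using T2m Q by measurable
      show "(\<lambda>y. \<Phi> (indicator P) y * indicator (T2 -` Q \<inter> space M2) y) \<in> borel_measurable M2"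
        using \<Phi>_ind[OF P] Q' by (auto simp: L2_def)
      show "AE y in M2. \<Phi> (indicator P') (T2 y) * indicator Q (T2 y)
          = \<Phi> (indicator P) y * indicator (T2 -` Q \<inter> space M2) y"
        using koop AE_space by eventually_elim (auto simp: indicator_def)
    qed
    finally show "(\<integral>x\<in>P. J (T2 -` Q \<inter> space M2) x \<partial>M1) = (\<integral>x\<in>P. J Q (T1 x) \<partial>M1)"
      using J_joint[OF P Q'] by simp
  qed
  have J_integral: "(\<integral>x. J Q x \<partial>M1) = M2.prob Q" if Q: "Q \<in> sets M2" for Q
  proof -
    have "(\<integral>x. J Q x \<partial>M1) = Re (\<integral>x. cnj (\<Psi> (indicator Q) x) \<partial>M1)"
      using \<Psi>_int[OF Q] by (simp add: J_def)
    also have "(\<integral>x. cnj (\<Psi> (indicator Q) x) \<partial>M1) = (\<integral>y. \<Phi> (\<lambda>x. 1) y * indicator Q y \<partial>M2)"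
      using adjoint_ind[OF L2_const[OF P1] Q, of 1] by simp
    also have "\<dots> = (\<integral>y. complex_of_real (indicator Q y) \<partial>M2)"
      using L2_operator_closed[OF \<Phi> L2_const[OF P1, of 1]] \<Phi>_1 Q
      by (intro integral_cong_AE) (auto simp: L2_def of_real_indicator)
    finally show ?thesis using Q by (simp only: integral_complex_of_real) simp
  qed

  \<comment> \<open>Restriction of the joining to the zero-entropy factor\<close>
  have sub: "subalgebra M2 F" and auto: "mp_automorphism (restr_to_subalg M2 F) T2"
    and ks: "ks_entropy (restr_to_subalg M2 F) T2 = 0"
    using F by (auto simp: factor_algebra_def)
  define N where "N = restr_to_subalg M2 F"
  have N: "space N = space M2" "sets N = sets F"
    using sub by (simp_all add: N_def space_restr_to_subalg sets_restr_to_subalg)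
  have N_M2: "Q \<in> sets M2" "measure N Q = M2.prob Q" if "Q \<in> sets N" for Q
    using that sub emeasure_restr_to_subalg[OF sub, of Q]
    by (auto simp: N subalgebra_def measure_def N_def[symmetric])
  interpret joining_density M1 T1 N T2 J
    using T1 auto J_int J_integral J_nonneg J_space J_Un J_equivariant N_M2
    by unfold_locales (auto simp: N N_def[symmetric])
  have AN: "A \<in> sets N" using A N by simp
  have "zero_entropy N T2 (\<lambda>y. y \<in> A)"
  proof -
    \<comment> \<open>\<open>ks_entropy\<close> ranges over partitions with values in the naturals,
      so membership is coded by 0 and 1 and decoded afterwards.\<close>
    let ?p = "\<lambda>y. of_bool (y \<in> A) :: nat"
    have p: "simple_function N ?p"
      using simple_function_compose[OF simple_function_mem[OF AN], of of_bool] by (simp add: comp_def)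
    have "ereal (entropy_of_partition N T2 ?p) \<le> ks_entropy N T2"
      unfolding ks_entropy_def using p by (intro SUP_upper) simp
    then have "entropy_of_partition N T2 ?p \<le> 0" using ks by (simp add: N_def zero_ereal_def)
    moreover have "0 \<le> entropy_of_partition N T2 ?p"
      by (rule LIMSEQ_le_const[OF itinerary_entropy_tendsto[OF S p]])
        (auto intro!: exI[of _ 0] divide_nonneg_nonneg partition_entropy_nonneg simple_function_itinerary S p
          mp_automorphism_prob_space[OF S])
    ultimately have "zero_entropy N T2 ?p" using zero_entropy_iff[OF S p] by simp
    then show ?thesis
      by (rule zero_entropy_compose[OF S p simple_function_mem[OF AN], where f = "\<lambda>k. k = 1"]) simp
  qed
  then have const: "AE x in M1. J A x = M2.prob A"
    using J_constant[OF K AN] N_M2(2)[OF AN] by simp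
  have A2: "A \<in> sets M2" using N_M2(1)[OF AN] .

  \<comment> \<open>Orthogonality to a dense range\<close>
  define c where "c = M2.prob A"
  have c: "0 \<le> c" "c \<le> 1" by (simp_all add: c_def)
  define h :: "'b \<Rightarrow> complex" where "h y = indicator A y - of_real c" for y
  have h_meas: "h \<in> borel_measurable M2" unfolding h_def using A2 by simp
  have h_le: "cmod (h y) \<le> 1" for y
  proof -
    have "h y = of_real (indicator A y - c)" by (simp add: h_def indicator_def)
    then have "cmod (h y) = \<bar>indicator A y - c\<bar>" by (simp only: norm_of_real)
    then show ?thesis using c by (simp add: indicator_def)
  qed
  have h_L2: "h \<in> L2 M2"
    unfolding L2_def using h_meas h_le
    by (auto intro!: M2.integrable_const_bound[where B = 1] simp: power_le_one)
  \<comment> \<open>Up to null sets, \<open>\<Psi>\<close> maps both \<open>indicator A\<close> and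
    the constant \<open>c\<close> to \<open>c\<close>, so their difference \<open>h\<close> pairs to
    0 with every \<open>\<Phi> f\<close>.\<close>
  have orth: "(\<integral>y. \<Phi> f y * h y \<partial>M2) = 0" if f: "f \<in> L2 M1" for f
  proof -
    have fi: "integrable M1 f" using P1 f by (rule L2_integrable)
    have \<Phi>f: "integrable M2 (\<Phi> f)" using P2 L2_operator_closed[OF \<Phi> f] by (rule L2_integrable)
    have "(\<integral>y. \<Phi> f y * indicator A y \<partial>M2) = (\<integral>x. f x * cnj (\<Psi> (indicator A) x) \<partial>M1)"
      by (rule adjoint_ind[OF f A2])
    also have "\<dots> = (\<integral>x. f x * of_real c \<partial>M1)"
    proof (rule integral_cong_AE)
      show "AE x in M1. f x * cnj (\<Psi> (indicator A) x) = f x * of_real c"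
        using const Im_0[OF A2] by eventually_elim (simp add: J_def c_def complex_eq_iff)
      have "integrable M1 (\<lambda>x. cnj (\<Psi> (indicator A) x))" using \<Psi>_int[OF A2] by simp
      then show "(\<lambda>x. f x * cnj (\<Psi> (indicator A) x)) \<in> borel_measurable M1"
        using fi by (intro borel_measurable_times borel_measurable_integrable)
    qed (use fi in simp)
    finally have 1: "(\<integral>y. \<Phi> f y * indicator A y \<partial>M2) = (\<integral>x. f x \<partial>M1) * of_real c" by simp
    have "L2_inner M2 (\<Phi> f) (\<lambda>y. 1) = (\<integral>x. f x * cnj (\<Psi> (\<lambda>y. 1) x) \<partial>M1)"
      using adjoint[OF f L2_const[OF P2, of 1]] by (simp add: L2_inner_def)
    also have "\<dots> = (\<integral>x. f x \<partial>M1)"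
    proof (rule integral_cong_AE)
      have "integrable M1 (\<lambda>x. cnj (\<Psi> (\<lambda>y. 1) x))"
        using L2_integrable[OF P1 L2_operator_closed[OF \<Psi> L2_const[OF P2, of 1]]] by simp
      then show "(\<lambda>x. f x * cnj (\<Psi> (\<lambda>y. 1) x)) \<in> borel_measurable M1"
        using fi by (intro borel_measurable_times borel_measurable_integrable)
      show "AE x in M1. f x * cnj (\<Psi> (\<lambda>y. 1) x) = f x"
        using \<Psi>_1 by eventually_elim simp
    qed (use fi in simp)
    finally have 2: "(\<integral>y. \<Phi> f y \<partial>M2) = (\<integral>x. f x \<partial>M1)" by (simp add: L2_inner_def)
    have "integrable M2 (\<lambda>y. \<Phi> f y * indicator A y)"
      using integrable_mult_indicator[OF A2 \<Phi>f] by (simp add: scaleR_conv_of_real of_real_indicator mult.commute)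
    then show ?thesis
      using \<Phi>f 1 2 by (simp add: h_def right_diff_distrib)
  qed
  \<comment> \<open>\<open>h\<close> is real, so this is its squared norm: the variance of the
    indicator of an event of probability \<open>c\<close>.\<close>
  have "(\<integral>y. h y * h y \<partial>M2) = of_real (c * (1 - c))"
  proof -
    have "h y * h y = of_real ((1 - 2 * c) * indicator A y + c\<^sup>2)" for y
      by (simp add: h_def indicator_def power2_eq_square algebra_simps)
    then have "(\<integral>y. h y * h y \<partial>M2) = of_real (\<integral>y. (1 - 2 * c) * indicator A y + c\<^sup>2 \<partial>M2)"
      by (simp only: integral_complex_of_real)
    also have "(\<integral>y. (1 - 2 * c) * indicator A y + c\<^sup>2 \<partial>M2) = (1 - 2 * c) * c + c\<^sup>2"
      using A2 by (simp add: c_def M2.prob_space M2.emeasure_eq_measure)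
    also have "\<dots> = c * (1 - c)" by (simp add: power2_eq_square algebra_simps)
    finally show ?thesis .
  qed
  \<comment> \<open>Subtracting the vanishing pairing with \<open>\<Phi> f\<close> leaves, up to
    sign, the pairing of \<open>h\<close> with a vector of norm below \<open>\<epsilon>\<close>. The
    form \<open>0 + \<epsilon>\<close> fits \<open>field_le_epsilon\<close>.\<close>
  moreover have "cmod (\<integral>y. h y * h y \<partial>M2) \<le> 0 + \<epsilon>" if e: "0 < \<epsilon>" for \<epsilon>
  proof -
    obtain f where f: "f \<in> L2 M1" "L2_norm M2 (\<lambda>y. \<Phi> f y - h y) < \<epsilon>"
      using dense h_L2 e unfolding L2_dense_range_def by blast
    have \<Phi>f: "\<Phi> f \<in> L2 M2" using \<Phi> f(1) by (rule L2_operator_closed)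
    have int: "integrable M2 (\<lambda>y. u y * h y)" if "u \<in> L2 M2" for u
    proof (rule Bochner_Integration.integrable_bound[OF L2_integrable[OF P2 that]])
      show "AE y in M2. cmod (u y * h y) \<le> cmod (u y)"
        using h_le by (simp add: norm_mult mult_left_le)
    qed (use that h_meas in \<open>auto simp: L2_def\<close>)
    have diff: "(\<lambda>y. \<Phi> f y - h y) \<in> L2 M2"
    proof -
      have meas: "(\<lambda>y. \<Phi> f y - h y) \<in> borel_measurable M2"
        using \<Phi>f h_meas by (intro borel_measurable_diff) (simp_all add: L2_def)
      have le: "(cmod (a - b))\<^sup>2 \<le> 2 * (cmod a)\<^sup>2 + 2 * (cmod b)\<^sup>2" for a b
      proof -
        have "(cmod (a - b))\<^sup>2 \<le> (cmod a + cmod b)\<^sup>2" by (intro power_mono norm_triangle_ineq4) simp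
        also have "\<dots> \<le> 2 * (cmod a)\<^sup>2 + 2 * (cmod b)\<^sup>2"
          using sum_squares_bound[of "cmod a" "cmod b"] by (simp add: power2_sum)
        finally show ?thesis .
      qed
      have "integrable M2 (\<lambda>y. 2 * (cmod (\<Phi> f y))\<^sup>2 + 2 * (cmod (h y))\<^sup>2)"
        using \<Phi>f h_L2 by (simp add: L2_def)
      then have "integrable M2 (\<lambda>y. (cmod (\<Phi> f y - h y))\<^sup>2)"
      proof (rule Bochner_Integration.integrable_bound)
        show "(\<lambda>y. (cmod (\<Phi> f y - h y))\<^sup>2) \<in> borel_measurable M2"
          using meas by measurable
        show "AE y in M2. norm ((cmod (\<Phi> f y - h y))\<^sup>2)
            \<le> norm (2 * (cmod (\<Phi> f y))\<^sup>2 + 2 * (cmod (h y))\<^sup>2)"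
          using le by simp
      qed
      with meas show ?thesis by (simp add: L2_def)
    qed
    have "(\<integral>y. (\<Phi> f y - h y) * h y \<partial>M2) = - (\<integral>y. h y * h y \<partial>M2)"
      using int[OF \<Phi>f] int[OF h_L2] orth[OF f(1)] by (simp add: left_diff_distrib)
    then have "cmod (\<integral>y. h y * h y \<partial>M2) = cmod (\<integral>y. (\<Phi> f y - h y) * h y \<partial>M2)" by simp
    also have "\<dots> \<le> L2_norm M2 (\<lambda>y. \<Phi> f y - h y)"
      using norm_integral_le_L2_norm[OF P2 diff h_meas h_le] .
    finally show ?thesis using f(2) by simp
  qed
  ultimately have "\<bar>c * (1 - c)\<bar> \<le> 0 + \<epsilon>" if "0 < \<epsilon>" for \<epsilon>
    using that by (simp only: norm_of_real)
  then have "\<bar>c * (1 - c)\<bar> \<le> 0" by (rule field_le_epsilon)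
  then have "c * (1 - c) = 0" by simp
  then show "measure M2 A = 0 \<or> measure M2 A = 1" by (simp add: c_def)
qed

theorem corollary12:
  fixes M1 :: "'a measure" and T1 :: "'a \<Rightarrow> 'a"
    and M2 :: "'b measure" and T2 :: "'b \<Rightarrow> 'b"
  assumes "std_automorphism M1 T1" and "std_automorphism M2 T2"
  shows "(markov_quasi_image M2 T2 M1 T1 \<longrightarrow> kolmogorov M1 T1 \<longrightarrow> kolmogorov M2 T2) \<and>
         (markov_quasi_similar M1 T1 M2 T2 \<longrightarrow> (kolmogorov M1 T1 \<longleftrightarrow> kolmogorov M2 T2))"
  using markov_quasi_image_kolmogorov[of M1 T1 M2 T2] markov_quasi_image_kolmogorov[of M2 T2 M1 T1] assms
  unfolding std_automorphism_def markov_quasi_similar_def by blast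

end
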